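(* For every $f\in\mathrm{Bir}_{2,2}(\mathbb P^{n-1})$ there exists a Jordan algebra $\mathbb J_f$ of rank $3$ (and dimension $n$) whose adjoint map $\#_{\mathbb J_f}:[x]\mapsto[x^\#]$ is linearly equivalent to $f$. In particular, every quadro-quadric Cremona transformation is linearly equivalent to an involution which is the adjoint map of a rank $3$ Jordan algebra.
   Context: $\mathrm{Bir}_{2,2}(\mathbb P^{n-1})$ denotes the set of birational maps of $\mathbb P^{n-1}$ such that both the map and its inverse are given by quadratic forms without common factor; these are the quadro-quadric Cremona transformations. Two such maps $f,f'$ are linearly equivalent if $f'=\ell_1\circ f\circ \ell_2$ for projective automorphisms $\ell_1,\ell_2$. A Jordan algebra is a finite-dimensional commutative complex algebra with unit $e$ satisfying $x^2(xy)=x(x^2y)$. Its rank is the dimension of the subalgebra generated by $e$ and a general element. In rank $3$ there are: \begin{itemize} \item a linear form $T$; \item a quadratic form $S$; \item a cubic form $N$ (the generic norm), \end{itemize} with $x^3-T(x)x^2+S(x)x-N(x)e=0$. The adjoint is $x^\#=x^2-T(x)x+S(x)e$; it satisfies $(x^\#)^\#=N(x)x$. *)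

theory Defs
  imports "HOL-Analysis.Analysis"
begin

text \<open>Points of the affine cone over P^{n-1} are vectors in complex ^ 'n, with n = CARD('n).
Homogeneous polynomials on complex ^ 'n are rendered as functions admitting an explicit
coefficient representation (over the infinite field C, polynomial identities are the same as
identities of functions).\<close>

definition lin_form :: "(complex ^ 'n \<Rightarrow> complex) \<Rightarrow> bool" where
  "lin_form l \<longleftrightarrow> (\<exists>a :: 'n \<Rightarrow> complex. \<forall>x. l x = (\<Sum>i\<in>UNIV. a i * x $ i))"

definition quad_form :: "(complex ^ 'n \<Rightarrow> complex) \<Rightarrow> bool" where
  "quad_form q \<longleftrightarrow> (\<exists>a :: 'n \<Rightarrow> 'n \<Rightarrow> complex.
      \<forall>x. q x = (\<Sum>i\<in>UNIV. \<Sum>j\<in>UNIV. a i j * x $ i * x $ j))"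

definition cubic_form :: "(complex ^ 'n \<Rightarrow> complex) \<Rightarrow> bool" where
  "cubic_form c \<longleftrightarrow> (\<exists>a :: 'n \<Rightarrow> 'n \<Rightarrow> 'n \<Rightarrow> complex.
      \<forall>x. c x = (\<Sum>i\<in>UNIV. \<Sum>j\<in>UNIV. \<Sum>k\<in>UNIV. a i j k * x $ i * x $ j * x $ k))"

definition quad_map :: "(complex ^ 'n \<Rightarrow> complex ^ 'n) \<Rightarrow> bool" where
  "quad_map F \<longleftrightarrow> (\<forall>i. quad_form (\<lambda>x. F x $ i))"

text \<open>The quadratic forms F_i have a common (non-constant) factor. Since they are homogeneous of
degree 2, a non-constant common divisor is homogeneous of degree 1 or 2.\<close>
definition has_common_factor :: "(complex ^ 'n \<Rightarrow> complex ^ 'n) \<Rightarrow> bool" where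
  "has_common_factor F \<longleftrightarrow>
     (\<exists>l m. lin_form l \<and> l \<noteq> (\<lambda>_. 0) \<and> (\<forall>i. lin_form (m i)) \<and>
            (\<forall>x i. F x $ i = l x * m i x))
   \<or> (\<exists>q c. quad_form q \<and> q \<noteq> (\<lambda>_. 0) \<and> (\<forall>x i. F x $ i = c i * q x))"

text \<open>Two vectors define the same point of projective space (or one of them is zero).\<close>
definition parallel :: "complex ^ 'n \<Rightarrow> complex ^ 'n \<Rightarrow> bool" where
  "parallel u v \<longleftrightarrow> (\<exists>c. u = c *s v) \<or> (\<exists>c. v = c *s u)"

definition same_rat_map :: "(complex ^ 'n \<Rightarrow> complex ^ 'n) \<Rightarrow> (complex ^ 'n \<Rightarrow> complex ^ 'n) \<Rightarrow> bool" where
  "same_rat_map F G \<longleftrightarrow> (\<exists>x. F x \<noteq> 0) \<and> (\<exists>x. G x \<noteq> 0) \<and> (\<forall>x. parallel (F x) (G x))"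

definition rat_left_inverse :: "(complex ^ 'n \<Rightarrow> complex ^ 'n) \<Rightarrow> (complex ^ 'n \<Rightarrow> complex ^ 'n) \<Rightarrow> bool" where
  "rat_left_inverse G F \<longleftrightarrow> same_rat_map (G \<circ> F) id"

definition bir22 :: "(complex ^ 'n \<Rightarrow> complex ^ 'n) \<Rightarrow> bool" where
  "bir22 F \<longleftrightarrow> quad_map F \<and> \<not> has_common_factor F \<and>
     (\<exists>G. quad_map G \<and> \<not> has_common_factor G \<and>
          rat_left_inverse G F \<and> rat_left_inverse F G)"

definition lin_equiv :: "(complex ^ 'n \<Rightarrow> complex ^ 'n) \<Rightarrow> (complex ^ 'n \<Rightarrow> complex ^ 'n) \<Rightarrow> bool" where
  "lin_equiv F F' \<longleftrightarrow> (\<exists>L1 L2 :: complex ^ 'n ^ 'n. invertible L1 \<and> invertible L2 \<and>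
      same_rat_map F' (\<lambda>x. L1 *v F (L2 *v x)))"

definition jordan_algebra :: "(complex ^ 'n \<Rightarrow> complex ^ 'n \<Rightarrow> complex ^ 'n) \<Rightarrow> complex ^ 'n \<Rightarrow> bool" where
  "jordan_algebra m e \<longleftrightarrow>
     (\<forall>a b x y z. m (a *s x + b *s y) z = a *s m x z + b *s m y z) \<and>
     (\<forall>x y. m x y = m y x) \<and>
     (\<forall>x. m e x = x) \<and>
     (\<forall>x y. m (m x x) (m x y) = m x (m (m x x) y))"

definition gen_subalg :: "(complex ^ 'n \<Rightarrow> complex ^ 'n \<Rightarrow> complex ^ 'n) \<Rightarrow> complex ^ 'n \<Rightarrow> complex ^ 'n \<Rightarrow> (complex ^ 'n) set" where
  "gen_subalg m e x = \<Inter>{V. vec.subspace V \<and> e \<in> V \<and> x \<in> V \<and> (\<forall>a\<in>V. \<forall>b\<in>V. m a b \<in> V)}"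

text \<open>Rank: dimension of the subalgebra generated by e and a general element
(this dimension is maximal, and attained, on a dense open set of elements).\<close>
definition jordan_rank :: "(complex ^ 'n \<Rightarrow> complex ^ 'n \<Rightarrow> complex ^ 'n) \<Rightarrow> complex ^ 'n \<Rightarrow> nat" where
  "jordan_rank m e = Max ((\<lambda>x. vec.dim (gen_subalg m e x)) ` UNIV)"

text \<open>T, S, N are the linear, quadratic, cubic forms of the generic minimal polynomial of a rank 3
Jordan algebra: x^3 - T(x) x^2 + S(x) x - N(x) e = 0.\<close>
definition rank3_data :: "(complex ^ 'n \<Rightarrow> complex ^ 'n \<Rightarrow> complex ^ 'n) \<Rightarrow> complex ^ 'n
    \<Rightarrow> (complex ^ 'n \<Rightarrow> complex) \<Rightarrow> (complex ^ 'n \<Rightarrow> complex) \<Rightarrow> (complex ^ 'n \<Rightarrow> complex) \<Rightarrow> bool" where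
  "rank3_data m e T S N \<longleftrightarrow> lin_form T \<and> quad_form S \<and> cubic_form N \<and>
     (\<forall>x. m x (m x x) - T x *s m x x + S x *s x - N x *s e = 0)"

definition jordan_adjoint :: "(complex ^ 'n \<Rightarrow> complex ^ 'n \<Rightarrow> complex ^ 'n) \<Rightarrow> complex ^ 'n
    \<Rightarrow> (complex ^ 'n \<Rightarrow> complex) \<Rightarrow> (complex ^ 'n \<Rightarrow> complex) \<Rightarrow> complex ^ 'n \<Rightarrow> complex ^ 'n" where
  "jordan_adjoint m e T S x = m x x - T x *s x + S x *s e"

end

theory Submission
  imports Defs "HOL-Computational_Algebra.Polynomial_Factorial"
    "HOL-Computational_Algebra.Fundamental_Theorem_Algebra" "HOL-Computational_Algebra.Field_as_Ring"
begin

text \<open>Let \<open>F\<close> and \<open>G\<close> be the quadratic maps, so \<open>G (F x) = N x x\<close> and \<open>F (G y) = M y y\<close> with cubic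
  forms \<open>N\<close>, \<open>M\<close>, and choose \<open>e\<close> with \<open>N e = 1\<close>. Differentiating the second equation at \<open>y = F x\<close>
  shows that \<open>N\<close> divides \<open>M'(F x) w\<close> times every component of \<open>F\<close>. As the components have no common
  factor, \<open>M'(F x) w = N x tau(x, w)\<close> with \<open>tau\<close> bilinear, and it follows that
  \<open>N' x v = tau(v, F x)\<close>. The linear map \<open>Q\<close> inverse to minus the derivative of \<open>F / N\<close> at \<open>e\<close> makes
  \<open>A = Q F\<close> the adjoint of a cubic norm structure with norm \<open>N\<close> and base point \<open>e\<close>: one has
  \<open>A (A x) = N x x\<close>, even if the trace form is degenerate. The Freudenthal-Springer-Tits
  construction turns such a structure into a Jordan algebra. If \<open>e\<close>, \<open>v\<close>, \<open>v\<^sup>2\<close> were dependent for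
  general \<open>v\<close>, then \<open>A\<close> would have a zero on the line through \<open>e\<close> and \<open>v\<close>, again contradicting
  the absence of a common factor; so the rank is 3.\<close>

section \<open>Homogeneous polynomials\<close>

text \<open>Forms are functions generated by the ring operations, so that closure properties are
  immediate and facts about all forms follow by rule induction. The zero function has every degree
  (\<open>hom_poly_zero\<close>).\<close>

inductive hom_poly :: "nat \<Rightarrow> (complex ^ 'n \<Rightarrow> complex) \<Rightarrow> bool" where
  const: "hom_poly 0 (\<lambda>x. c)"
| coord: "hom_poly 1 (\<lambda>x. x $ i)"
| add: "hom_poly d f \<Longrightarrow> hom_poly d g \<Longrightarrow> hom_poly d (\<lambda>x. f x + g x)"
| mult: "hom_poly a f \<Longrightarrow> hom_poly b g \<Longrightarrow> hom_poly (a + b) (\<lambda>x. f x * g x)"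

lemma hom_poly_mult:
  assumes "hom_poly a f" "hom_poly b g" "d = a + b"
  shows "hom_poly d (\<lambda>x. f x * g x)"
  using hom_poly.mult[OF assms(1,2)] assms(3) by simp

lemma hom_poly_cmult: "hom_poly d f \<Longrightarrow> hom_poly d (\<lambda>x. c * f x)"
  by (rule hom_poly_mult[OF hom_poly.const]) auto

lemma hom_poly_divide: "hom_poly d f \<Longrightarrow> hom_poly d (\<lambda>x. f x / c)"
  using hom_poly_cmult[of d f "1 / c"] by simp

lemma hom_poly_diff:
  assumes "hom_poly d f" "hom_poly d g"
  shows "hom_poly d (\<lambda>x. f x - g x)"
  using hom_poly.add[OF assms(1) hom_poly_cmult[OF assms(2), of "-1"]] by simp

lemma hom_poly_zero: "hom_poly d (\<lambda>x :: complex ^ 'n. 0)"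
proof -
  have "\<exists>f :: complex ^ 'n \<Rightarrow> complex. hom_poly d f"
  proof (induction d)
    case 0
    show ?case by (rule exI, rule hom_poly.const)
  next
    case (Suc d)
    then obtain f :: "complex ^ 'n \<Rightarrow> complex" where "hom_poly d f" by blast
    from hom_poly.mult[OF hom_poly.coord this] show ?case by auto
  qed
  then obtain f :: "complex ^ 'n \<Rightarrow> complex" where "hom_poly d f" by blast
  from hom_poly_cmult[OF this, of 0] show ?thesis by simp
qed

lemma hom_poly_sum:
  assumes "\<And>i. i \<in> I \<Longrightarrow> hom_poly d (f i)"
  shows "hom_poly d (\<lambda>x. \<Sum>i\<in>I. f i x)"
  using assms
proof (induction I rule: infinite_finite_induct)
  case (insert i I)
  then show ?case using hom_poly.add[of d "f i" "\<lambda>x. \<Sum>i\<in>I. f i x"] by simp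
qed (auto simp: hom_poly_zero)

lemma hom_poly_0D: "hom_poly d f \<Longrightarrow> d = 0 \<Longrightarrow> \<exists>c. f = (\<lambda>x. c)"
  by (induction rule: hom_poly.induct) auto

text \<open>One coordinate is split off, from the left factor of a product or, if that factor is
  constant, from the right one. Iterating this recovers the explicit coefficient sums for degrees 1,
  2 and 3.\<close>

lemma hom_poly_SucD:
  fixes f :: "complex ^ 'n \<Rightarrow> complex"
  assumes "hom_poly k f" "k = Suc d"
  shows "\<exists>g. (\<forall>i. hom_poly d (g i)) \<and> (\<forall>x. f x = (\<Sum>i\<in>UNIV. g i x * x $ i))"
  using assms
proof (induction arbitrary: d rule: hom_poly.induct)
  case (const c)
  then show ?case by simp
next
  case (coord i)
  have "hom_poly d (\<lambda>x :: complex ^ 'n. if j = i then 1 else 0)" for j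
    using hom_poly.const[of "if j = i then 1 else 0"] coord by simp
  moreover have "x $ i = (\<Sum>j\<in>UNIV. (if j = i then 1 else 0) * x $ j)" for x :: "complex ^ 'n"
    by (simp add: if_distrib[of "\<lambda>u. u * _"] cong: if_cong)
  ultimately show ?case
    by (intro exI[of _ "\<lambda>j x. if j = i then 1 else 0"]) auto
next
  case (add a f g)
  obtain p q where p: "\<forall>i. hom_poly d (p i)" "\<forall>x. f x = (\<Sum>i\<in>UNIV. p i x * x $ i)"
    and q: "\<forall>i. hom_poly d (q i)" "\<forall>x. g x = (\<Sum>i\<in>UNIV. q i x * x $ i)"
    using add.IH[OF add.prems] by blast
  show ?case
    by (rule exI[of _ "\<lambda>i x. p i x + q i x"])
      (use p q in \<open>auto intro!: hom_poly.add simp: sum.distrib distrib_right\<close>)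
next
  case (mult a f b g)
  show ?case
  proof (cases a)
    case 0
    then obtain c where c: "f = (\<lambda>x. c)" using hom_poly_0D mult.hyps(1) by blast
    obtain q where q: "\<forall>i. hom_poly d (q i)" "\<forall>x. g x = (\<Sum>i\<in>UNIV. q i x * x $ i)"
      using mult.IH(2)[of d] mult.prems 0 by auto
    show ?thesis
      by (rule exI[of _ "\<lambda>i x. c * q i x"])
        (use c q in \<open>auto intro!: hom_poly_cmult simp: sum_distrib_left mult.assoc\<close>)
  next
    case (Suc a')
    then obtain p where p: "\<forall>i. hom_poly a' (p i)" "\<forall>x. f x = (\<Sum>i\<in>UNIV. p i x * x $ i)"
      using mult.IH(1) by metis
    have "d = a' + b" using mult.prems Suc by simp
    then have "hom_poly d (\<lambda>x. p i x * g x)" for i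
      using hom_poly.mult p(1) mult.hyps(2) by blast
    moreover have "f x * g x = (\<Sum>i\<in>UNIV. p i x * g x * x $ i)" for x
      by (simp only: p(2)[rule_format] sum_distrib_left sum_distrib_right mult_ac)
    ultimately show ?thesis by (intro exI[of _ "\<lambda>i x. p i x * g x"]) blast
  qed
qed

lemma hom_poly_lin_form: "hom_poly 1 f \<longleftrightarrow> lin_form f"
proof
  assume "hom_poly 1 f"
  moreover have "1 = Suc 0" by simp
  ultimately obtain g where
    g: "\<And>i. hom_poly 0 (g i)" "\<And>x. f x = (\<Sum>i\<in>UNIV. g i x * x $ i)"
    using hom_poly_SucD by blast
  then have "\<exists>c. g i = (\<lambda>x. c)" for i using hom_poly_0D by blast
  then obtain a where "\<And>i. g i = (\<lambda>x. a i)" by metis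
  with g show "lin_form f" unfolding lin_form_def by auto
next
  assume "lin_form f"
  then obtain a where f: "f = (\<lambda>x. \<Sum>i\<in>UNIV. a i * x $ i)" unfolding lin_form_def by blast
  show "hom_poly 1 f" unfolding f by (intro hom_poly_sum hom_poly_cmult hom_poly.coord)
qed

lemma hom_poly_quad_form: "hom_poly 2 f \<longleftrightarrow> quad_form f"
proof
  assume "hom_poly 2 f"
  moreover have "2 = Suc 1" by simp
  ultimately obtain g where
    g: "\<And>i. hom_poly 1 (g i)" "\<And>x. f x = (\<Sum>i\<in>UNIV. g i x * x $ i)"
    using hom_poly_SucD by blast
  then have "\<exists>a. \<forall>x. g i x = (\<Sum>j\<in>UNIV. a j * x $ j)" for i
    using g(1) unfolding hom_poly_lin_form lin_form_def by blast
  then obtain a where a: "\<And>i x. g i x = (\<Sum>j\<in>UNIV. a i j * x $ j)" by metis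
  show "quad_form f" unfolding quad_form_def
    by (intro exI[of _ a] allI) (simp only: g(2) a sum_distrib_left sum_distrib_right mult_ac)
next
  assume "quad_form f"
  then obtain a where f: "f = (\<lambda>x. \<Sum>i\<in>UNIV. \<Sum>j\<in>UNIV. a i j * x $ i * x $ j)"
    unfolding quad_form_def by blast
  show "hom_poly 2 f" unfolding f
    by (intro hom_poly_sum hom_poly_mult[where a = 1 and b = 1] hom_poly_cmult hom_poly.coord) simp
qed

lemma hom_poly_cubic_form: "hom_poly 3 f \<longleftrightarrow> cubic_form f"
proof
  assume "hom_poly 3 f"
  moreover have "3 = Suc 2" by simp
  ultimately obtain g where
    g: "\<And>i. hom_poly 2 (g i)" "\<And>x. f x = (\<Sum>i\<in>UNIV. g i x * x $ i)"
    using hom_poly_SucD by blast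
  from g(1) have "\<forall>i. \<exists>a. \<forall>x. g i x = (\<Sum>j\<in>UNIV. \<Sum>k\<in>UNIV. a j k * x $ j * x $ k)"
    unfolding hom_poly_quad_form quad_form_def by blast
  then have "\<exists>a. \<forall>i x. g i x = (\<Sum>j\<in>UNIV. \<Sum>k\<in>UNIV. a i j k * x $ j * x $ k)"
    by (rule choice)
  then obtain a where a: "\<And>i x. g i x = (\<Sum>j\<in>UNIV. \<Sum>k\<in>UNIV. a i j k * x $ j * x $ k)" by blast
  show "cubic_form f" unfolding cubic_form_def
    by (intro exI[of _ a] allI) (simp only: g(2) a sum_distrib_left sum_distrib_right mult_ac)
next
  assume "cubic_form f"
  then obtain a where
    f: "f = (\<lambda>x. \<Sum>i\<in>UNIV. \<Sum>j\<in>UNIV. \<Sum>k\<in>UNIV. a i j k * x $ i * x $ j * x $ k)"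
    unfolding cubic_form_def by blast
  have "hom_poly (1 + 1 + 1) f" unfolding f
    by (intro hom_poly_sum hom_poly.mult hom_poly_cmult hom_poly.coord)
  then show "hom_poly 3 f" by (simp add: eval_nat_numeral)
qed

section \<open>Restriction to lines and density\<close>

lemma hom_poly_line:
  assumes "hom_poly d f"
  shows "\<exists>p. \<forall>t. f (x + t *s y) = poly p t"
  using assms
proof (induction rule: hom_poly.induct)
  case (const c)
  show ?case by (rule exI[of _ "[:c:]"]) simp
next
  case (coord i)
  show ?case by (rule exI[of _ "[:x $ i, y $ i:]"]) simp
next
  case (add d f g)
  then show ?case by (metis poly_add)
next
  case (mult a f b g)
  then show ?case by (metis poly_mult)
qed

text \<open>On the line through \<open>x0\<close> and \<open>x\<close> both forms become polynomials
  in one variable with product zero; the first is nonzero at 0, so the second vanishes. Identities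
  of forms therefore need checking only on a nonempty set where some form is nonzero.\<close>

lemma hom_poly_dense:
  assumes f: "hom_poly a f" and g: "hom_poly b g"
    and ne: "f x0 \<noteq> 0" and gf: "\<And>x. f x \<noteq> 0 \<Longrightarrow> g x = 0"
  shows "g x = 0"
proof -
  obtain p q where p: "\<And>t. f (x0 + t *s (x - x0)) = poly p t"
    and q: "\<And>t. g (x0 + t *s (x - x0)) = poly q t"
    using hom_poly_line[OF f] hom_poly_line[OF g] by metis
  have "poly (p * q) t = 0" for t using gf p q by (metis mult_eq_0_iff poly_mult)
  then have "p * q = 0" using poly_all_0_iff_0 by blast
  moreover have "poly p 0 \<noteq> 0" using p[of 0] ne by simp
  ultimately have "q = 0" by auto
  then show ?thesis using q[of 1] by simp
qed

section \<open>Vector-valued forms\<close>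

definition hom_map :: "nat \<Rightarrow> (complex ^ 'n \<Rightarrow> complex ^ 'm) \<Rightarrow> bool" where
  "hom_map d f \<longleftrightarrow> (\<forall>i. hom_poly d (\<lambda>x. f x $ i))"

lemma hom_map_nth: "hom_map d f \<Longrightarrow> hom_poly d (\<lambda>x. f x $ i)"
  by (simp add: hom_map_def)

lemma hom_map_const: "hom_map 0 (\<lambda>x. c)"
  by (simp add: hom_map_def hom_poly.const)

lemma hom_map_id: "hom_map 1 (\<lambda>x. x)"
  unfolding hom_map_def by (intro allI hom_poly.coord)

lemma hom_map_add: "hom_map d f \<Longrightarrow> hom_map d g \<Longrightarrow> hom_map d (\<lambda>x. f x + g x)"
  by (simp add: hom_map_def hom_poly.add)

lemma hom_map_diff: "hom_map d f \<Longrightarrow> hom_map d g \<Longrightarrow> hom_map d (\<lambda>x. f x - g x)"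
  by (simp add: hom_map_def hom_poly_diff)

lemma hom_map_scale:
  "hom_poly a f \<Longrightarrow> hom_map b g \<Longrightarrow> d = a + b \<Longrightarrow> hom_map d (\<lambda>x. f x *s g x)"
  by (auto simp: hom_map_def intro!: hom_poly.mult)

lemma hom_poly_compose:
  assumes "hom_poly d f" "hom_map 1 g"
  shows "hom_poly d (\<lambda>x. f (g x))"
  using assms(1)
proof (induction rule: hom_poly.induct)
  case (coord i)
  then show ?case using hom_map_nth[OF assms(2)] by simp
qed (auto intro: hom_poly.intros)

lemma hom_map_dense:
  assumes f: "hom_poly a f" and g: "hom_map b g"
    and ne: "f x0 \<noteq> 0" and gf: "\<And>x. f x \<noteq> 0 \<Longrightarrow> g x = 0"
  shows "g x = 0"
proof -
  have "g x $ i = 0" for i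
    by (rule hom_poly_dense[OF f hom_map_nth[OF g] ne]) (simp add: gf)
  then show ?thesis by (simp add: vec_eq_iff)
qed

text \<open>A difference quotient in direction \<open>u\<close>, built by a discrete product rule.
  The guard \<open>k > 0\<close> is there because \<open>k - 1\<close> is truncated: for a constant
  the quotient need not be a form of any prescribed degree.\<close>

lemma hom_poly_divided_difference:
  assumes "hom_poly k f" and l: "lin_form l"
  shows "\<exists>g. (k > 0 \<longrightarrow> hom_poly (k - 1) g) \<and> (\<forall>x. f x = f (x - l x *s u) + l x * g x)"
  using assms(1)
proof (induction rule: hom_poly.induct)
  case (const c)
  show ?case by (rule exI[of _ "\<lambda>x. 0"]) simp
next
  case (coord i)
  show ?case by (rule exI[of _ "\<lambda>x. u $ i"]) (simp add: hom_poly.const[simplified])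
next
  case (add d f g)
  then obtain p q where "(d > 0 \<longrightarrow> hom_poly (d - 1) p)" "\<And>x. f x = f (x - l x *s u) + l x * p x"
    "(d > 0 \<longrightarrow> hom_poly (d - 1) q)" "\<And>x. g x = g (x - l x *s u) + l x * q x" by blast
  note pq = this
  have "f x + g x = f (x - l x *s u) + g (x - l x *s u) + l x * (p x + q x)" for x
    by (subst pq(2), subst pq(4)) (simp add: distrib_left)
  with pq(1,3) show ?case
    by (intro exI[of _ "\<lambda>x. p x + q x"]) (blast intro: hom_poly.add)
next
  case (mult a f b g)
  then obtain p q where p: "(a > 0 \<longrightarrow> hom_poly (a - 1) p)" "\<And>x. f x = f (x - l x *s u) + l x * p x"
    and q: "(b > 0 \<longrightarrow> hom_poly (b - 1) q)" "\<And>x. g x = g (x - l x *s u) + l x * q x" by blast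
  have l1: "hom_poly 1 l" using l hom_poly_lin_form by blast
  have "hom_map 1 (\<lambda>x. x - l x *s u)"
    by (intro hom_map_diff hom_map_id hom_map_scale[OF l1 hom_map_const]) simp
  then have f': "hom_poly a (\<lambda>x. f (x - l x *s u))" and g': "hom_poly b (\<lambda>x. g (x - l x *s u))"
    using mult.hyps hom_poly_compose by blast+
  have "F * G = F' * G' + L * (P * G + F' * Q)"
    if "F = F' + L * P" "G = G' + L * Q" for F G F' G' L P Q :: complex
    using that by (simp add: algebra_simps)
  from this[OF p(2) q(2)] have eq: "f x * g x = f (x - l x *s u) * g (x - l x *s u)
      + l x * (p x * g x + f (x - l x *s u) * q x)" for x .
  show ?case
  \<comment> \<open>A factor of degree 0 is constant and contributes no difference, so only the
    quotient of the other factor appears.\<close>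
  proof (cases "a = 0 \<or> b = 0")
    case False
    then have "hom_poly (a + b - 1) (\<lambda>x. p x * g x)"
      by (intro hom_poly_mult[OF _ mult.hyps(2), of "a - 1"]) (use p(1) in auto)
    moreover have "hom_poly (a + b - 1) (\<lambda>x. f (x - l x *s u) * q x)"
      by (rule hom_poly_mult[OF f', of "b - 1"]) (use False q(1) in auto)
    ultimately have "hom_poly (a + b - 1) (\<lambda>x. p x * g x + f (x - l x *s u) * q x)"
      by (rule hom_poly.add)
    then show ?thesis
      using eq by (intro exI[of _ "\<lambda>x. p x * g x + f (x - l x *s u) * q x"]) blast
  next
    case True
    then show ?thesis
    proof
      assume a: "a = 0"
      then obtain c where c: "f = (\<lambda>x. c)" using hom_poly_0D mult.hyps(1) by blast
      have "f x * g x = f (x - l x *s u) * g (x - l x *s u) + l x * (c * q x)" for x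
        unfolding c by (subst q(2)) (simp add: distrib_left)
      moreover have "a + b > 0 \<longrightarrow> hom_poly (a + b - 1) (\<lambda>x. c * q x)"
        using a q(1) by (simp add: hom_poly_cmult)
      ultimately show ?thesis by (intro exI[of _ "\<lambda>x. c * q x"]) blast
    next
      assume b: "b = 0"
      then obtain c where c: "g = (\<lambda>x. c)" using hom_poly_0D mult.hyps(2) by blast
      have "f x * g x = f (x - l x *s u) * g (x - l x *s u) + l x * (c * p x)" for x
        unfolding c by (subst p(2)) (simp add: distrib_left distrib_right)
      moreover have "a + b > 0 \<longrightarrow> hom_poly (a + b - 1) (\<lambda>x. c * p x)"
        using b p(1) by (simp add: hom_poly_cmult)
      ultimately show ?thesis by (intro exI[of _ "\<lambda>x. c * p x"]) blast
    qed
  qed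
qed

text \<open>As \<open>l u = 1\<close>, the point \<open>x - l x *s u\<close> lies in the kernel of
  \<open>l\<close>, so the remainder in the divided difference vanishes.\<close>

lemma hom_poly_factor_lin_form:
  assumes f: "hom_poly (Suc d) f" and l: "lin_form l" and u: "l u = 1"
    and zero: "\<And>x. l x = 0 \<Longrightarrow> f x = 0"
  shows "\<exists>g. hom_poly d g \<and> (\<forall>x. f x = l x * g x)"
proof -
  obtain g where g: "hom_poly d g" "\<And>x. f x = f (x - l x *s u) + l x * g x"
    using hom_poly_divided_difference[OF f l, of u] by auto
  obtain a where a: "\<And>x. l x = (\<Sum>i\<in>UNIV. a i * x $ i)" using l unfolding lin_form_def by blast
  have "l (x - c *s u) = l x - c * l u" for x c
    by (simp add: a sum_subtractf sum_distrib_left algebra_simps)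
  then have "l (x - l x *s u) = 0" for x by (simp add: u)
  with zero g show ?thesis by (metis add_0)
qed

text \<open>A pointwise scalar becomes a form: the \<open>i\<close>-th component of \<open>H\<close>
  vanishes wherever the \<open>i\<close>-th coordinate does, so that coordinate divides it. The
  quotient is the scalar where the coordinate is nonzero, hence by density everywhere.\<close>

lemma hom_map_parallel_id:
  fixes H :: "complex ^ 'n \<Rightarrow> complex ^ 'n"
  assumes H: "hom_map (Suc d) H" and par: "\<And>x. \<exists>c. H x = c *s x"
  shows "\<exists>N. hom_poly d N \<and> (\<forall>x. H x = N x *s x)"
proof -
  define i :: 'n where "i = undefined"
  have l: "lin_form (\<lambda>x :: complex ^ 'n. x $ i)"
    using hom_poly.coord hom_poly_lin_form by blast
  have z: "x $ i = 0 \<Longrightarrow> H x $ i = 0" for x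
    using par[of x] by auto
  have "\<exists>N. hom_poly d N \<and> (\<forall>x. H x $ i = x $ i * N x)"
    by (rule hom_poly_factor_lin_form[OF hom_map_nth[OF H] l, of "axis i 1"]) (simp_all add: z axis_def)
  then obtain N where N: "hom_poly d N" "\<And>x. H x $ i = x $ i * N x" by blast
  have "H x - N x *s x = 0" for x
  proof (rule hom_map_dense[where f = "\<lambda>x :: complex ^ 'n. x $ i" and g = "\<lambda>x. H x - N x *s x"
        and ?x0.0 = "axis i 1"])
    show "hom_poly 1 (\<lambda>x :: complex ^ 'n. x $ i)" by (rule hom_poly.coord)
    show "hom_map (Suc d) (\<lambda>x. H x - N x *s x)"
      by (intro hom_map_diff H hom_map_scale[OF N(1) hom_map_id]) simp
    fix x :: "complex ^ 'n" assume "x $ i \<noteq> 0"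
    moreover obtain c where c: "H x = c *s x" using par by blast
    moreover have "c * x $ i = x $ i * N x" using N(2)[of x] c by simp
    ultimately show "H x - N x *s x = 0" by simp
  qed (simp add: axis_def)
  with N show ?thesis by auto
qed

section \<open>Quadratic maps and cubic forms\<close>

locale sym_bilinear =
  fixes B :: "complex ^ 'n \<Rightarrow> complex ^ 'n \<Rightarrow> complex ^ 'm"
  assumes commute: "B x y = B y x"
    and add_left: "B (x + y) z = B x z + B y z"
    and scale_left: "B (c *s x) z = c *s B x z"
begin

lemma add_right: "B z (x + y) = B z x + B z y"
  by (simp add: commute[of z] add_left)

lemma scale_right: "B z (c *s x) = c *s B z x"
  by (simp add: commute[of z] scale_left)

lemma zero_left [simp]: "B 0 z = 0"
  using scale_left[of 0 0 z] by simp

lemma zero_right [simp]: "B z 0 = 0"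
  by (simp add: commute[of z])

lemma diff_left: "B (x - y) z = B x z - B y z"
  using add_left[of x "- y" z] scale_left[of "- 1" y z] by simp

lemma diff_right: "B z (x - y) = B z x - B z y"
  by (simp add: commute[of z] diff_left)

lemmas bilinear = add_left add_right scale_left scale_right diff_left diff_right

lemma sum_left: "B (\<Sum>i\<in>I. f i) z = (\<Sum>i\<in>I. B (f i) z)"
  by (induction I rule: infinite_finite_induct) (auto simp: add_left)

lemma sum_right: "B z (\<Sum>i\<in>I. f i) = (\<Sum>i\<in>I. B z (f i))"
  by (simp add: commute[of z] sum_left)

lemma expansion: "B x y = (\<Sum>i\<in>UNIV. \<Sum>j\<in>UNIV. (x $ i * y $ j) *s B (axis i 1) (axis j 1))"
proof -
  have "B x y = B (\<Sum>i\<in>UNIV. x $ i *s axis i 1) (\<Sum>j\<in>UNIV. y $ j *s axis j 1)"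
    by (simp only: basis_expansion)
  also have "\<dots> = (\<Sum>i\<in>UNIV. \<Sum>j\<in>UNIV. (x $ i * y $ j) *s B (axis i 1) (axis j 1))"
    unfolding sum_left unfolding sum_right
    by (intro sum.cong refl) (simp add: scale_left scale_right)
  finally show ?thesis .
qed

lemma hom_map:
  assumes "hom_map a f" "hom_map b g" "d = a + b"
  shows "hom_map d (\<lambda>x. B (f x) (g x))"
  unfolding hom_map_def
proof
  fix k
  have "hom_poly d (\<lambda>x. \<Sum>i\<in>UNIV. \<Sum>j\<in>UNIV. (B (axis i 1) (axis j 1) $ k) * (f x $ i * g x $ j))"
    by (intro hom_poly_sum hom_poly_cmult hom_poly_mult[OF hom_map_nth hom_map_nth]) (use assms in auto)
  then show "hom_poly d (\<lambda>x. B (f x) (g x) $ k)"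
    by (subst expansion) (simp add: mult.commute)
qed

text \<open>The factor 1/2 makes \<open>B\<close> the full polarization of \<open>quad\<close>, so
  \<open>B x y\<close> is the derivative of \<open>quad\<close> at \<open>x\<close> in direction
  \<open>y\<close>.\<close>

definition quad :: "complex ^ 'n \<Rightarrow> complex ^ 'm" where
  "quad x = (1 / 2) *s B x x"

lemma self: "B x x = 2 *s quad x"
  by (simp add: quad_def)

lemma quad_zero [simp]: "quad 0 = 0"
  by (simp add: quad_def)

lemma quad_scale: "quad (c *s x) = c\<^sup>2 *s quad x"
  by (simp add: quad_def scale_left scale_right power2_eq_square)

lemma quad_add: "quad (x + y) = quad x + B x y + quad y"
  by (simp add: quad_def bilinear commute[of y x] vec_eq_iff algebra_simps)

lemma quad_diff: "quad (x - y) = quad x - B x y + quad y"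
  by (simp add: quad_def bilinear commute[of y x] vec_eq_iff algebra_simps)

lemma quad_line: "quad (t *s e + v) = t\<^sup>2 *s quad e + t *s B e v + quad v"
  by (simp add: quad_add quad_scale scale_left)

lemma hom_map_quad: "hom_map a f \<Longrightarrow> d = a + a \<Longrightarrow> hom_map d (\<lambda>x. quad (f x))"
  unfolding quad_def by (intro hom_map_scale[OF hom_poly.const hom_map]) auto

end

lemma quad_map_obtains_bilinear:
  assumes "quad_map F"
  shows "\<exists>B. sym_bilinear B \<and> F = sym_bilinear.quad B"
proof -
  have "\<forall>k. \<exists>a. \<forall>x. F x $ k = (\<Sum>i\<in>UNIV. \<Sum>j\<in>UNIV. a i j * x $ i * x $ j)"
    using assms unfolding quad_map_def quad_form_def by blast
  then have "\<exists>a. \<forall>k x. F x $ k = (\<Sum>i\<in>UNIV. \<Sum>j\<in>UNIV. a k i j * x $ i * x $ j)"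
    by (rule choice)
  then obtain a where a: "F x $ k = (\<Sum>i\<in>UNIV. \<Sum>j\<in>UNIV. a k i j * x $ i * x $ j)" for k x
    by blast
  define b where "b k x y = (\<Sum>i\<in>UNIV. \<Sum>j\<in>UNIV. a k i j * x $ i * y $ j)" for k and x y :: "complex ^ 'a"
  have b: "b k (x + y) z = b k x z + b k y z" "b k z (x + y) = b k z x + b k z y"
    "b k (c *s x) z = c * b k x z" "b k z (c *s x) = c * b k z x" for k x y z c
    by (simp_all add: b_def sum.distrib[symmetric] sum_distrib_left algebra_simps)
  let ?B = "\<lambda>x y. \<chi> k. b k x y + b k y x"
  have B: "sym_bilinear ?B"
    by unfold_locales (simp_all add: vec_eq_iff b algebra_simps)
  moreover have "F = sym_bilinear.quad ?B"
    unfolding sym_bilinear.quad_def[OF B] by (rule ext) (simp add: vec_eq_iff a b_def)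
  ultimately show ?thesis by blast
qed

section \<open>Cubic forms and their polarizations\<close>

locale sym_trilinear =
  fixes C :: "complex ^ 'n \<Rightarrow> complex ^ 'n \<Rightarrow> complex ^ 'n \<Rightarrow> complex"
  assumes commute: "C x y z = C y x z" and commute': "C x y z = C x z y"
    and add1: "C (x + y) z w = C x z w + C y z w"
    and scale1: "C (c *s x) z w = c * C x z w"
begin

lemma add2: "C z (x + y) w = C z x w + C z y w"
  by (simp add: commute[of z] add1)

lemma scale2: "C z (c *s x) w = c * C z x w"
  by (simp add: commute[of z] scale1)

lemma add3: "C z w (x + y) = C z w x + C z w y"
  by (simp add: commute'[of z w] add2)

lemma scale3: "C z w (c *s x) = c * C z w x"
  by (simp add: commute'[of z w] scale2)

lemma diff1: "C (x - y) z w = C x z w - C y z w"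
  using add1[of x "- y" z w] scale1[of "- 1" y z w] by simp

lemma diff2: "C z (x - y) w = C z x w - C z y w"
  by (simp add: commute[of z] diff1)

lemma diff3: "C z w (x - y) = C z w x - C z w y"
  by (simp add: commute'[of z w] diff2)

lemmas trilinear = add1 add2 add3 scale1 scale2 scale3 diff1 diff2 diff3

lemma zero [simp]: "C 0 z w = 0" "C z 0 w = 0" "C z w 0 = 0"
  using scale1[of 0 0] scale2[of _ 0 0] scale3[of _ _ 0 0] by auto

lemma sum1: "C (\<Sum>i\<in>I. f i) z w = (\<Sum>i\<in>I. C (f i) z w)"
  by (induction I rule: infinite_finite_induct) (auto simp: add1)

lemma sum2: "C z (\<Sum>i\<in>I. f i) w = (\<Sum>i\<in>I. C z (f i) w)"
  by (simp add: commute[of z] sum1)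

lemma sum3: "C z w (\<Sum>i\<in>I. f i) = (\<Sum>i\<in>I. C z w (f i))"
  by (simp add: commute'[of z w] sum2)

lemma expansion: "C x y z = (\<Sum>i\<in>UNIV. \<Sum>j\<in>UNIV. \<Sum>k\<in>UNIV.
    C (axis i 1) (axis j 1) (axis k 1) * (x $ i * y $ j * z $ k))"
proof -
  have "C x y z = C (\<Sum>i\<in>UNIV. x $ i *s axis i 1) (\<Sum>j\<in>UNIV. y $ j *s axis j 1)
      (\<Sum>k\<in>UNIV. z $ k *s axis k 1)" by (simp only: basis_expansion)
  also have "\<dots> = (\<Sum>i\<in>UNIV. \<Sum>j\<in>UNIV. \<Sum>k\<in>UNIV.
      C (axis i 1) (axis j 1) (axis k 1) * (x $ i * y $ j * z $ k))"
    unfolding sum1 unfolding sum2 unfolding sum3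
    by (intro sum.cong refl) (simp add: scale1 scale2 scale3)
  finally show ?thesis .
qed

lemma hom_poly:
  assumes "hom_map a f" "hom_map b g" "hom_map c h" "d = a + b + c"
  shows "hom_poly d (\<lambda>x. C (f x) (g x) (h x))"
  by (subst expansion, intro hom_poly_sum hom_poly_cmult hom_poly_mult[OF hom_poly.mult]
      hom_map_nth) (use assms in auto)

text \<open>With the factor 1/6, \<open>C\<close> is the full polarization: \<open>deriv x y\<close>
  is the derivative of \<open>cubic\<close> at \<open>x\<close> in direction \<open>y\<close>, and
  \<open>C x\<close> is the second derivative at \<open>x\<close>.\<close>

definition cubic :: "complex ^ 'n \<Rightarrow> complex" where
  "cubic x = C x x x / 6"

definition deriv :: "complex ^ 'n \<Rightarrow> complex ^ 'n \<Rightarrow> complex" where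
  "deriv x y = C x x y / 2"

lemma hom_poly_cubic: "hom_map a f \<Longrightarrow> d = a + a + a \<Longrightarrow> hom_poly d (\<lambda>x. cubic (f x))"
  unfolding cubic_def by (intro hom_poly_divide hom_poly) auto

lemma hom_poly_deriv:
  "hom_map a f \<Longrightarrow> hom_map b g \<Longrightarrow> d = a + a + b \<Longrightarrow> hom_poly d (\<lambda>x. deriv (f x) (g x))"
  unfolding deriv_def by (intro hom_poly_divide hom_poly) auto

lemma deriv_linear:
  "deriv x (y + z) = deriv x y + deriv x z" "deriv x (y - z) = deriv x y - deriv x z"
  "deriv x (c *s y) = c * deriv x y" "deriv 0 y = 0" "deriv x 0 = 0"
  by (simp_all add: deriv_def trilinear add_divide_distrib diff_divide_distrib)

lemma deriv_scale: "deriv (c *s x) y = c\<^sup>2 * deriv x y"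
  by (simp add: deriv_def trilinear power2_eq_square)

lemma deriv_add: "deriv (x + y) w = deriv x w + C x y w + deriv y w"
  by (simp add: deriv_def trilinear commute[of y x] add_divide_distrib)

lemma deriv_self: "deriv x x = 3 * cubic x"
  by (simp add: deriv_def cubic_def)

lemma cubic_zero [simp]: "cubic 0 = 0"
  by (simp add: cubic_def)

lemma cubic_scale: "cubic (c *s x) = c ^ 3 * cubic x"
  by (simp add: cubic_def trilinear power3_eq_cube)

lemma cubic_add: "cubic (x + y) = cubic x + deriv x y + deriv y x + cubic y"
proof -
  have "C y y x = C x y y" "C y x y = C x y y" "C y x x = C x x y" "C x y x = C x x y"
    using commute commute' by metis+
  then show ?thesis by (simp add: cubic_def deriv_def trilinear field_simps)
qed

end

lemma hom_poly_3_obtains_trilinear: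
  fixes N :: "complex ^ 'n \<Rightarrow> complex"
  assumes "hom_poly 3 N"
  shows "\<exists>C. sym_trilinear C \<and> N = sym_trilinear.cubic C"
proof -
  obtain a where a: "N x = (\<Sum>i\<in>UNIV. \<Sum>j\<in>UNIV. \<Sum>k\<in>UNIV. a i j k * x $ i * x $ j * x $ k)" for x
    using assms unfolding hom_poly_cubic_form cubic_form_def by blast
  define b where "b x y z = (\<Sum>i\<in>UNIV. \<Sum>j\<in>UNIV. \<Sum>k\<in>UNIV. a i j k * x $ i * y $ j * z $ k)"
    for x y z :: "complex ^ 'n"
  have b: "b (x + y) z w = b x z w + b y z w" "b z (x + y) w = b z x w + b z y w"
    "b z w (x + y) = b z w x + b z w y" "b (c *s x) z w = c * b x z w"
    "b z (c *s x) w = c * b z x w" "b z w (c *s x) = c * b z w x" for x y z w c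
    by (simp_all add: b_def sum.distrib[symmetric] sum_distrib_left algebra_simps)
  let ?C = "\<lambda>x y z. b x y z + b x z y + b y x z + b y z x + b z x y + b z y x"
  have C: "sym_trilinear ?C"
    by unfold_locales (simp_all add: b algebra_simps)
  moreover have "N = sym_trilinear.cubic ?C"
    unfolding sym_trilinear.cubic_def[OF C] by (rule ext) (simp add: a b_def)
  ultimately show ?thesis by blast
qed

section \<open>Common zeros on lines\<close>

lemma has_common_factorI1:
  assumes "lin_form l" "\<And>i. lin_form (m i)" "\<And>x i. F x $ i = l x * m i x" "F e \<noteq> 0"
  shows "has_common_factor F"
proof -
  have "l \<noteq> (\<lambda>_. 0)" using assms(3)[of e] assms(4) by (auto simp: vec_eq_iff)
  then show ?thesis using assms(1-3) unfolding has_common_factor_def by blast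
qed

lemma has_common_factorI2:
  assumes "quad_form q" "\<And>x i. F x $ i = c i * q x" "F e \<noteq> 0"
  shows "has_common_factor F"
proof -
  have "q \<noteq> (\<lambda>_. 0)" using assms(2)[of e] assms(3) by (auto simp: vec_eq_iff)
  then show ?thesis using assms(1-2) unfolding has_common_factor_def by blast
qed

text \<open>After cancelling the gcd of \<open>p\<close> and \<open>h\<close>, the remaining factor
  \<open>u\<close> of \<open>p\<close> divides every \<open>f i\<close>. A root of \<open>u\<close>
  would be a common root of all \<open>f i\<close>, so \<open>u\<close> is constant.\<close>

lemma poly_dvd_from_products:
  fixes p h :: "complex poly"
  assumes dvd: "\<And>i. p dvd h * f i" and no_root: "\<And>t. \<exists>i. poly (f i) t \<noteq> 0" and p: "p \<noteq> 0"
  shows "p dvd h"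
proof -
  obtain u w where u: "p = u * gcd p h" and w: "h = w * gcd p h" and cop: "coprime u w"
    using gcd_coprime_exists[of p h] p by auto
  have u_dvd: "u dvd f i" for i
  proof -
    have "gcd p h * u dvd gcd p h * (w * f i)"
      using dvd[of i] u w by (metis mult.assoc mult.commute)
    then have "u dvd w * f i" using p by (simp add: dvd_mult_cancel_left)
    then show ?thesis using cop coprime_dvd_mult_right_iff by blast
  qed
  have "degree u = 0"
  proof (rule ccontr)
    assume "degree u \<noteq> 0"
    then obtain t where t: "poly u t = 0"
      using fundamental_theorem_of_algebra[of u] constant_degree[of u] by auto
    obtain i where "poly (f i) t \<noteq> 0" using no_root by blast
    moreover have "[:- t, 1:] dvd f i" using t u_dvd[of i] poly_eq_0_iff_dvd dvd_trans by blast
    ultimately show False by (simp add: poly_eq_0_iff_dvd)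
  qed
  moreover have "u \<noteq> 0" using u p by auto
  ultimately have "is_unit u" using is_unit_iff_degree by blast
  then have "p dvd gcd p h" using u by (metis dvd_refl mult_unit_dvd_iff')
  then show ?thesis using dvd_trans by blast
qed

lemma coeffs_4:
  fixes a0 :: complex
  assumes "\<And>t. a0 + a1 * t + a2 * t\<^sup>2 + a3 * t ^ 3 + a4 * t ^ 4
     = b0 + b1 * t + b2 * t\<^sup>2 + b3 * t ^ 3 + b4 * t ^ 4"
  shows "a1 = b1" "a2 = b2"
proof -
  have "poly [:a0, a1, a2, a3, a4:] t = poly [:b0, b1, b2, b3, b4:] t" for t
    using assms[of t] by (simp add: algebra_simps power2_eq_square power3_eq_cube power4_eq_xxxx)
  then have "[:a0, a1, a2, a3, a4:] = [:b0, b1, b2, b3, b4:]" by (simp add: poly_eq_poly_eq_iff[symmetric] ext)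
  then show "a1 = b1" "a2 = b2" by auto
qed

text \<open>With \<open>t\<^sup>2 + a t + b = 0\<close> and \<open>t h1 + h2 = 0\<close> the equations of a common zero on the line through
  \<open>e\<close> and \<open>v\<close>, the resultants of these equations are forms in \<open>v\<close>. If all of them vanished
  identically, \<open>- h2 / h1\<close> would be integral over the polynomials, hence a linear form, and it
  would give a common factor.\<close>

lemma line_without_zeros:
  fixes F :: "complex ^ 'n \<Rightarrow> complex ^ 'n"
  assumes "sym_bilinear B" and F: "F = sym_bilinear.quad B"
    and ncf: "\<not> has_common_factor F" and e: "F e \<noteq> 0"
  shows "\<exists>R d v. hom_poly d R \<and> R v \<noteq> 0 \<and> (\<forall>v. R v \<noteq> 0 \<longrightarrow> (\<forall>t. F (t *s e + v) \<noteq> 0))"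
proof (rule ccontr)
  assume neg: "\<not> ?thesis"
  interpret sym_bilinear B by fact
  \<comment> \<open>Read contrapositively, \<open>neg\<close> says that a form vanishing at every
    \<open>v\<close> whose line meets a zero of \<open>F\<close> is zero.\<close>
  have dense: "R v = 0" if "hom_poly d R" "\<And>v t. F (t *s e + v) = 0 \<Longrightarrow> R v = 0" for R d v
    using neg that by blast
  obtain i0 where i0: "F e $ i0 \<noteq> 0" using e by (auto simp: vec_eq_iff)
  \<comment> \<open>A linear functional with value 1 at \<open>F e\<close>. It splits
    \<open>F (t *s e + v) = 0\<close> into a monic quadratic equation for \<open>t\<close> and the
    remaining vector equation \<open>t *s h1 v + h2 v = 0\<close>.\<close>
  define lam :: "complex ^ 'n \<Rightarrow> complex" where "lam y = y $ i0 / F e $ i0" for y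
  have lam: "lam (x + y) = lam x + lam y" "lam (c *s x) = c * lam x" "lam (F e) = 1" for x y c
    using i0 by (simp_all add: lam_def add_divide_distrib)
  define a where "a v = lam (B e v)" for v
  define b where "b v = lam (F v)" for v
  define h1 where "h1 v = B e v - a v *s F e" for v
  define h2 where "h2 v = F v - b v *s F e" for v
  have hom_Be: "hom_map 1 (B e)"
    using hom_map[OF hom_map_const hom_map_id] by simp
  have hom_F: "hom_map 2 F"
    unfolding F by (rule hom_map_quad[OF hom_map_id]) simp
  have hom_a: "hom_poly 1 a" and hom_b: "hom_poly 2 b"
    unfolding a_def b_def lam_def
    using hom_poly_divide[OF hom_map_nth[OF hom_Be]] hom_poly_divide[OF hom_map_nth[OF hom_F]] by auto
  have hom_h1: "hom_map 1 h1" unfolding h1_def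
    by (intro hom_map_diff hom_Be hom_map_scale[OF hom_a hom_map_const]) simp
  have hom_h2: "hom_map 2 h2" unfolding h2_def
    by (intro hom_map_diff hom_F hom_map_scale[OF hom_b hom_map_const]) simp
  have zero: "t\<^sup>2 + a v * t + b v = 0 \<and> h2 v = - (t *s h1 v)" if "F (t *s e + v) = 0" for t v
  proof -
    have z: "t\<^sup>2 *s F e + t *s B e v + F v = 0" using that quad_line F by simp
    have "lam (t\<^sup>2 *s F e + t *s B e v + F v) = t\<^sup>2 + a v * t + b v"
      by (simp add: lam a_def b_def)
    then have q: "t\<^sup>2 + a v * t + b v = 0" using z by (simp add: lam_def)
    have "h2 v + t *s h1 v = (t\<^sup>2 *s F e + t *s B e v + F v) - (t\<^sup>2 + a v * t + b v) *s F e"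
      by (simp add: h1_def h2_def vec_eq_iff algebra_simps)
    then show ?thesis using z q by (simp add: eq_neg_iff_add_eq_0)
  qed
  show False
  proof (cases "\<forall>v. h1 v = 0")
    \<comment> \<open>Here \<open>h2\<close> vanishes as well, so every component of
      \<open>F\<close> is a multiple of the quadratic form \<open>b\<close>.\<close>
    case True
    have h2_zero: "h2 v $ i = 0" for v i
      by (rule dense[OF hom_map_nth[OF hom_h2]]) (use zero True in auto)
    have "F v $ i = F e $ i * b v" for v i using h2_zero[of v i] by (simp add: h2_def)
    moreover have "quad_form b" using hom_b hom_poly_quad_form by blast
    ultimately show False using has_common_factorI2 ncf e by blast
  next
    case False
    then obtain v0 k where v0: "h1 v0 $ k \<noteq> 0" by (auto simp: vec_eq_iff)
    define l where "l v = h1 v $ k" for v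
    have hom_l: "hom_poly 1 l" unfolding l_def by (rule hom_map_nth[OF hom_h1])
    \<comment> \<open>\<open>E1\<close> expresses that the vectors \<open>h1 v\<close> and
      \<open>h2 v\<close> are proportional; \<open>E2\<close> is the monic quadratic at
      \<open>t = - h2 v $ k / l v\<close>, multiplied by the square of \<open>l v\<close>.\<close>
    have E1: "h1 v $ j * h2 v $ k - h2 v $ j * l v = 0" for v j
    proof (rule dense)
      show "hom_poly 3 (\<lambda>v. h1 v $ j * h2 v $ k - h2 v $ j * l v)"
        by (intro hom_poly_diff hom_poly_mult[OF hom_map_nth[OF hom_h1] hom_map_nth[OF hom_h2]]
          hom_poly_mult[OF hom_map_nth[OF hom_h2] hom_l]) auto
    qed (auto dest!: zero simp: l_def)
    have E2: "h2 v $ k * h2 v $ k - a v * l v * h2 v $ k + b v * (l v * l v) = 0" for v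
    proof (rule dense)
      show "hom_poly 4 (\<lambda>v. h2 v $ k * h2 v $ k - a v * l v * h2 v $ k + b v * (l v * l v))"
        by (intro hom_poly.add hom_poly_diff hom_poly_mult[OF hom_map_nth[OF hom_h2] hom_map_nth[OF hom_h2]]
          hom_poly_mult[OF hom_poly.mult[OF hom_a hom_l] hom_map_nth[OF hom_h2]]
          hom_poly_mult[OF hom_b hom_poly.mult[OF hom_l hom_l]]) auto
      fix v t assume "F (t *s e + v) = 0"
      from zero[OF this] have q: "t\<^sup>2 + a v * t + b v = 0" and h: "h2 v $ k = - (t * l v)"
        by (auto simp: l_def)
      have "h2 v $ k * h2 v $ k - a v * l v * h2 v $ k + b v * (l v * l v)
        = (t\<^sup>2 + a v * t + b v) * (l v * l v)"
        unfolding h by (simp add: algebra_simps power2_eq_square)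
      then show "h2 v $ k * h2 v $ k - a v * l v * h2 v $ k + b v * (l v * l v) = 0" using q by simp
    qed
    have "lin_form l" using hom_l hom_poly_lin_form by blast
    moreover have "l ((1 / l v0) *s v0) = 1"
    proof -
      obtain \<alpha> where "l = (\<lambda>x. \<Sum>i\<in>UNIV. \<alpha> i * x $ i)"
        using \<open>lin_form l\<close> unfolding lin_form_def by blast
      then have "l (c *s x) = c * l x" for c x by (simp add: sum_distrib_left mult_ac)
      then show ?thesis using v0 by (simp add: l_def)
    qed
    \<comment> \<open>By \<open>E2\<close> the square of \<open>h2 v $ k\<close> vanishes with
      \<open>l v\<close>, so \<open>l\<close> divides \<open>h2 v $ k\<close>. The quotient
      \<open>s\<close> is a linear form, and \<open>- s v\<close> is the common root, as the next
      two identities show.\<close>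
    moreover have "h2 v $ k = 0" if "l v = 0" for v using E2[of v] that by simp
    moreover have "hom_poly (Suc 1) (\<lambda>v. h2 v $ k)" using hom_map_nth[OF hom_h2] by (simp add: numeral_2_eq_2)
    ultimately obtain s where s: "hom_poly 1 s" "\<And>v. h2 v $ k = l v * s v"
      using hom_poly_factor_lin_form[of 1 "\<lambda>v. h2 v $ k" l] by blast
    have h2: "h2 v $ j - h1 v $ j * s v = 0" for v j
    proof (rule hom_poly_dense[OF hom_l, where ?x0.0 = v0 and g = "\<lambda>v. h2 v $ j - h1 v $ j * s v"])
      show "hom_poly 2 (\<lambda>v. h2 v $ j - h1 v $ j * s v)"
        by (intro hom_poly_diff hom_map_nth[OF hom_h2] hom_poly_mult[OF hom_map_nth[OF hom_h1] s(1)]) simp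
      fix v assume "l v \<noteq> 0"
      moreover have "l v * (h2 v $ j - h1 v $ j * s v) = 0"
        using E1[of v j] s(2)[of v] by (auto simp: algebra_simps)
      ultimately show "h2 v $ j - h1 v $ j * s v = 0" by simp
    qed (use v0 l_def in simp)
    have b: "b v - s v * (a v - s v) = 0" for v
    proof (rule hom_poly_dense[OF hom_l, where ?x0.0 = v0 and g = "\<lambda>v. b v - s v * (a v - s v)"])
      show "hom_poly 2 (\<lambda>v. b v - s v * (a v - s v))"
        by (intro hom_poly_diff hom_b hom_poly_mult[OF s(1) hom_poly_diff[OF hom_a s(1)]]) simp
      fix v assume "l v \<noteq> 0"
      moreover have "l v * l v * (b v - s v * (a v - s v)) = 0"
        using E2[of v] s(2)[of v] by (simp add: algebra_simps)
      ultimately show "b v - s v * (a v - s v) = 0" by simp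
    qed (use v0 l_def in simp)
    \<comment> \<open>Substituting both identities exhibits \<open>s\<close> as a common linear
      factor.\<close>
    have "F v $ i = s v * ((a v - s v) * F e $ i + h1 v $ i)" for v i
    proof -
      have "F v $ i = b v * F e $ i + h2 v $ i" by (simp add: h2_def)
      moreover have "h2 v $ i = h1 v $ i * s v" "b v = s v * (a v - s v)" using h2 b by auto
      ultimately show ?thesis by (simp add: algebra_simps)
    qed
    moreover have "lin_form s" using s(1) hom_poly_lin_form by blast
    moreover have "hom_poly 1 (\<lambda>v. (a v - s v) * F e $ i + h1 v $ i)" for i
      by (intro hom_poly.add hom_map_nth[OF hom_h1] hom_poly_mult[OF hom_poly_diff[OF hom_a s(1)] hom_poly.const]) simp
    ultimately show False
      using has_common_factorI1[of s "\<lambda>i v. (a v - s v) * F e $ i + h1 v $ i" F e] hom_poly_lin_form ncf e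
      by blast
  qed
qed

section \<open>Mutually inverse quadratic maps\<close>

locale cubic_composition =
  F: sym_bilinear F2 + G: sym_bilinear G2 + N: sym_trilinear N3
  for F2 G2 :: "complex ^ 'n \<Rightarrow> complex ^ 'n \<Rightarrow> complex ^ 'n"
    and N3 :: "complex ^ 'n \<Rightarrow> complex ^ 'n \<Rightarrow> complex ^ 'n \<Rightarrow> complex" +
  assumes comp: "G.quad (F.quad x) = N.cubic x *s x"
begin

text \<open>These are the coefficients of \<open>t\<close> and of its square in \<open>comp\<close>
  at \<open>x + t *s y\<close>.\<close>

lemma comp_linearized:
  shows comp_deriv: "G2 (F.quad x) (F2 x y) = N.cubic x *s y + N.deriv x y *s x"
    and comp_deriv2: "G.quad (F2 x y) + G2 (F.quad x) (F.quad y) = N.deriv x y *s y + N.deriv y x *s x"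
proof -
  have "G2 (F.quad x) (F2 x y) $ k = (N.cubic x *s y + N.deriv x y *s x) $ k"
    "(G.quad (F2 x y) + G2 (F.quad x) (F.quad y)) $ k = (N.deriv x y *s y + N.deriv y x *s x) $ k" for k
  proof -
    define a0 a3 a4 where "a0 = G.quad (F.quad x) $ k" and "a3 = G2 (F2 x y) (F.quad y) $ k"
      and "a4 = G.quad (F.quad y) $ k"
    have eq: "a0 + G2 (F.quad x) (F2 x y) $ k * t
        + (G.quad (F2 x y) + G2 (F.quad x) (F.quad y)) $ k * t\<^sup>2 + a3 * t ^ 3 + a4 * t ^ 4
      = (N.cubic x * x $ k) + (N.cubic x *s y + N.deriv x y *s x) $ k * t
        + (N.deriv x y *s y + N.deriv y x *s x) $ k * t\<^sup>2
        + (N.deriv y x * y $ k + N.cubic y * x $ k) * t ^ 3 + (N.cubic y * y $ k) * t ^ 4" for t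
    proof -
      have "F.quad (x + t *s y) = F.quad x + (t *s F2 x y + t\<^sup>2 *s F.quad y)"
        by (simp add: F.quad_add F.quad_scale F.scale_right add.assoc)
      moreover have "N.cubic (x + t *s y)
          = N.cubic x + t * N.deriv x y + t\<^sup>2 * N.deriv y x + t ^ 3 * N.cubic y"
        by (simp add: N.cubic_add N.cubic_scale N.deriv_linear N.deriv_scale)
      ultimately have "G.quad (F.quad x + (t *s F2 x y + t\<^sup>2 *s F.quad y)) $ k
          = (N.cubic x + t * N.deriv x y + t\<^sup>2 * N.deriv y x + t ^ 3 * N.cubic y) * (x $ k + t * y $ k)"
        using comp[of "x + t *s y"] by (simp add: algebra_simps)
      then show ?thesis
        unfolding a0_def a3_def a4_def
        by (simp add: G.quad_add G.quad_scale G.bilinear algebra_simps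
            power2_eq_square power3_eq_cube power4_eq_xxxx)
    qed
    show "G2 (F.quad x) (F2 x y) $ k = (N.cubic x *s y + N.deriv x y *s x) $ k"
      "(G.quad (F2 x y) + G2 (F.quad x) (F.quad y)) $ k = (N.deriv x y *s y + N.deriv y x *s x) $ k"
      using coeffs_4[OF eq] by auto
  qed
  then show "G2 (F.quad x) (F2 x y) = N.cubic x *s y + N.deriv x y *s x"
    "G.quad (F2 x y) + G2 (F.quad x) (F.quad y) = N.deriv x y *s y + N.deriv y x *s x"
    by (auto simp only: vec_eq_iff)
qed

end

locale quadro_quadric =
  GF: cubic_composition F2 G2 N3 + FG: cubic_composition G2 F2 M3
  for F2 G2 :: "complex ^ 'n \<Rightarrow> complex ^ 'n \<Rightarrow> complex ^ 'n"
    and N3 M3 :: "complex ^ 'n \<Rightarrow> complex ^ 'n \<Rightarrow> complex ^ 'n \<Rightarrow> complex"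
begin

notation GF.F.quad ("F")
notation GF.G.quad ("G")
notation GF.N.cubic ("N")
notation FG.N.cubic ("M")
notation GF.N.deriv ("N''")
notation FG.N.deriv ("M''")

lemma N_zero_if: "F x = 0 \<Longrightarrow> N x = 0"
  using GF.comp[of x] by (auto simp: GF.N.cubic_zero)

text \<open>Both sides are the scalar by which \<open>F (G (F x))\<close> is a multiple of
  \<open>F x\<close>, computed by associating the composition in two ways.\<close>

lemma M_F: "M (F x) = (N x)\<^sup>2"
proof (cases "F x = 0")
  case True
  then show ?thesis by (simp add: N_zero_if)
next
  case False
  have "M (F x) *s F x = F (G (F x))" by (simp add: FG.comp)
  also have "\<dots> = (N x)\<^sup>2 *s F x" by (simp add: GF.comp GF.F.quad_scale)
  finally show ?thesis using False by simp
qed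

text \<open>The derivative of \<open>F (G y) = M y *s y\<close> at \<open>y = F x\<close>. The right
  side displays the factor \<open>N x\<close>, which is what the divisibility argument below
  exploits.\<close>

lemma deriv_M_F: "M' (F x) w *s F x = N x *s (F2 x (G2 (F x) w) - N x *s w)"
proof -
  have "N x *s F2 x (G2 (F x) w) = (N x)\<^sup>2 *s w + M' (F x) w *s F x"
    using FG.comp_deriv[of "F x" w] by (simp add: GF.comp M_F GF.F.scale_left)
  then show ?thesis by (simp add: vec_eq_iff algebra_simps power2_eq_square)
qed

text \<open>This is the chain rule for \<open>M_F\<close>, obtained by putting
  \<open>w = F2 x v\<close> in \<open>deriv_M_F\<close> and cancelling the vector
  \<open>F x\<close>.\<close>

lemma deriv_M_F_F2: "M' (F x) (F2 x v) = 2 * N x * N' x v"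
proof (cases "F x = 0")
  case True
  then show ?thesis by (simp add: FG.N.deriv_linear N_zero_if)
next
  case False
  have "M' (F x) (F2 x v) *s F x = (2 * N x * N' x v) *s F x"
    unfolding deriv_M_F GF.comp_deriv
    by (simp add: GF.F.bilinear GF.F.self vec_eq_iff algebra_simps)
  then show ?thesis using False by simp
qed

end

locale pointed_quadro_quadric = quadro_quadric F2 G2 N3 M3
  for F2 G2 :: "complex ^ 'n \<Rightarrow> complex ^ 'n \<Rightarrow> complex ^ 'n" and N3 M3 +
  fixes e :: "complex ^ 'n"
  assumes N_e: "N e = 1"
    and no_zeros: "\<exists>R d v. hom_poly d R \<and> R v \<noteq> 0 \<and> (\<forall>v. R v \<noteq> 0 \<longrightarrow> (\<forall>t. F (t *s e + v) \<noteq> 0))"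
begin

text \<open>On the line \<open>t *s e + v\<close>, dividing the quartic \<open>M' (F x) w\<close> by
  the monic cubic \<open>N x\<close> leaves a linear quotient in \<open>t\<close>;
  \<open>tau v w\<close> is its constant term, computed from the two top coefficients of the
  quartic.\<close>

definition tau :: "complex ^ 'n \<Rightarrow> complex ^ 'n \<Rightarrow> complex" where
  "tau v w = M3 (F e) (F2 e v) w - M' (F e) w * N' e v"

lemma tau_linear:
  "tau (x + y) w = tau x w + tau y w" "tau (x - y) w = tau x w - tau y w" "tau (c *s x) w = c * tau x w"
  "tau v (x + y) = tau v x + tau v y" "tau v (x - y) = tau v x - tau v y" "tau v (c *s x) = c * tau v x"
  by (simp_all add: tau_def GF.F.bilinear FG.N.trilinear FG.N.deriv_linear GF.N.deriv_linear algebra_simps)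

lemma hom_poly_tau:
  assumes "hom_map a f" "hom_map b g" "d = a + b"
  shows "hom_poly d (\<lambda>x. tau (f x) (g x))"
  unfolding tau_def
  by (intro hom_poly_diff FG.N.hom_poly[OF hom_map_const GF.F.hom_map[OF hom_map_const assms(1) refl] assms(2)]
      hom_poly_mult[OF FG.N.hom_poly_deriv[OF hom_map_const assms(2) refl]
        GF.N.hom_poly_deriv[OF hom_map_const assms(1) refl]])
    (use assms(3) in auto)

text \<open>On the line through \<open>e\<close> and a general \<open>v\<close> the cubic \<open>N\<close> divides \<open>M' (F x) w\<close> times every
  component of \<open>F\<close>, and these have no common root. The two leading coefficients determine the
  quotient, which is \<open>tau\<close>.\<close>

lemma N_dvd_deriv_M_F: "M' (F v) w = N v * tau v w"
proof -
  obtain R d v0 where R: "hom_poly d R" "R v0 \<noteq> 0" "\<And>v t. R v \<noteq> 0 \<Longrightarrow> F (t *s e + v) \<noteq> 0"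
    using no_zeros by blast
  have "M' (F v) w - N v * tau v w = 0"
  proof (rule hom_poly_dense[OF R(1), where ?x0.0 = v0 and g = "\<lambda>v. M' (F v) w - N v * tau v w"])
    show "hom_poly 4 (\<lambda>v. M' (F v) w - N v * tau v w)"
      by (intro hom_poly_diff FG.N.hom_poly_deriv[OF GF.F.hom_map_quad[OF hom_map_id] hom_map_const]
          hom_poly_mult[OF GF.N.hom_poly_cubic[OF hom_map_id] hom_poly_tau[OF hom_map_id hom_map_const]]) auto
  next
    fix v assume v: "R v \<noteq> 0"
    \<comment> \<open>\<open>pN\<close>, \<open>ph\<close> and \<open>pF i\<close> are the
      restrictions to the line of \<open>N\<close>, of \<open>M' (F x) w\<close> and of the
      components of \<open>F\<close>. The leading coefficient of \<open>pN\<close> is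
      \<open>N e = 1\<close>.\<close>
    define pN where "pN = [:N v, N' v e, N' e v, 1:]"
    define h0 h1 h2 where "h0 = M' (F v) w" and "h1 = M3 (F v) (F2 e v) w"
      and "h2 = M' (F2 e v) w + M3 (F v) (F e) w"
    define ph where "ph = [:h0, h1, h2, M3 (F e) (F2 e v) w, M' (F e) w:]"
    define pF where "pF i = [:F v $ i, F2 e v $ i, F e $ i:]" for i
    have line: "F (t *s e + v) = F v + t *s F2 e v + t\<^sup>2 *s F e" for t
      unfolding GF.F.quad_line by (simp add: add_ac)
    have pN: "poly pN t = N (t *s e + v)" for t
      by (simp add: pN_def GF.N.cubic_add GF.N.cubic_scale GF.N.deriv_linear GF.N.deriv_scale N_e
          algebra_simps power2_eq_square power3_eq_cube)
    have ph: "poly ph t = M' (F (t *s e + v)) w" for t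
      unfolding line ph_def h0_def h1_def h2_def add.assoc FG.N.deriv_add FG.N.deriv_scale
        FG.N.add2 FG.N.scale1 FG.N.scale2 FG.N.commute[of "F e" "F2 e v"]
      by (simp add: algebra_simps power2_eq_square)
    have pF: "poly (pF i) t = F (t *s e + v) $ i" for i t
      unfolding line pF_def by (simp add: algebra_simps power2_eq_square)
    have "pN dvd ph"
    proof (rule poly_dvd_from_products[where f = pF])
      show "pN \<noteq> 0" by (simp add: pN_def)
      show "\<exists>i. poly (pF i) t \<noteq> 0" for t
        using R(3)[OF v, of t] by (auto simp: pF vec_eq_iff)
      fix i
      have "hom_map 3 (\<lambda>x. F2 x (G2 (F x) w) - N x *s w)"
        by (intro hom_map_diff GF.F.hom_map[OF hom_map_id GF.G.hom_map[OF GF.F.hom_map_quad[OF hom_map_id]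
              hom_map_const]] hom_map_scale[OF GF.N.hom_poly_cubic[OF hom_map_id] hom_map_const]) auto
      from hom_poly_line[OF hom_map_nth[OF this]] obtain K where
        K: "\<And>t. (F2 (v + t *s e) (G2 (F (v + t *s e)) w) - N (v + t *s e) *s w) $ i = poly K t"
        by blast
      have "poly (ph * pF i) t = poly (pN * K) t" for t
      proof -
        have "M' (F (t *s e + v)) w * F (t *s e + v) $ i = N (t *s e + v) *
            (F2 (t *s e + v) (G2 (F (t *s e + v)) w) - N (t *s e + v) *s w) $ i"
          using arg_cong[OF deriv_M_F[of "t *s e + v" w], of "\<lambda>u. u $ i"] by (simp add: algebra_simps)
        also have "\<dots> = N (t *s e + v) * poly K t"
          using K[of t] by (simp only: add.commute)
        finally show ?thesis by (simp only: ph pF pN poly_mult)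
      qed
      then have "ph * pF i = pN * K" by (simp add: poly_eq_poly_eq_iff[symmetric] ext)
      then show "pN dvd ph * pF i" by simp
    qed
    then obtain k where k: "ph = pN * k" by blast
    obtain k0 k' where k': "k = pCons k0 k'" by (cases k)
    obtain k1 k'' where k'': "k' = pCons k1 k''" by (cases k')
    \<comment> \<open>The degrees 4 and 3 of dividend and divisor bound the degree of the quotient
      by 1.\<close>
    have "k'' = 0"
    proof (rule ccontr)
      assume "k'' \<noteq> 0"
      then have "degree k \<ge> 2" and "k \<noteq> 0" by (auto simp: k' k'')
      moreover have "degree pN = 3" "pN \<noteq> 0" by (auto simp: pN_def)
      ultimately have "degree ph \<ge> 5" unfolding k by (simp add: degree_mult_eq)
      moreover have "degree ph \<le> 4" unfolding ph_def by (simp add: degree_pCons_le)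
      ultimately show False by simp
    qed
    then have "ph = pN * [:k0, k1:]" using k k' k'' by simp
    then have "h0 = N v * k0" "M3 (F e) (F2 e v) w = k0 + k1 * N' e v" "M' (F e) w = k1"
      by (auto simp: ph_def pN_def algebra_simps)
    then show "M' (F v) w - N v * tau v w = 0"
      by (simp add: h0_def tau_def)
  qed (rule R(2))
  then show ?thesis by simp
qed

text \<open>Insert \<open>N_dvd_deriv_M_F\<close> into \<open>deriv_M_F_F2\<close> and cancel
  \<open>N x\<close>, by density where it vanishes.\<close>

lemma tau_F2: "tau x (F2 x v) = 2 * N' x v"
proof -
  have "tau x (F2 x v) - 2 * N' x v = 0"
  proof (rule hom_poly_dense[where f = N and ?x0.0 = e and g = "\<lambda>x. tau x (F2 x v) - 2 * N' x v"])
    show "hom_poly 3 N" by (rule GF.N.hom_poly_cubic[OF hom_map_id]) simp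
    show "hom_poly 2 (\<lambda>x. tau x (F2 x v) - 2 * N' x v)"
      by (intro hom_poly_diff hom_poly_tau[OF hom_map_id GF.F.hom_map[OF hom_map_id hom_map_const]]
          hom_poly_cmult GF.N.hom_poly_deriv[OF hom_map_id hom_map_const]) auto
    show "N x \<noteq> 0 \<Longrightarrow> tau x (F2 x v) - 2 * N' x v = 0" for x
      using deriv_M_F_F2[of x v] by (simp add: N_dvd_deriv_M_F)
  qed (simp add: N_e)
  then show ?thesis by simp
qed

text \<open>Polarize \<open>tau_F2\<close>: at \<open>x + v\<close> in direction \<open>x\<close>,
  remove the instances at \<open>x\<close> and at \<open>v\<close>. What remains presents
  \<open>F\<close> as a gradient of \<open>N\<close> with respect to \<open>tau\<close>.\<close>

lemma tau_F: "tau v (F x) = N' x v"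
proof -
  have "tau (x + v) (F2 (x + v) x) = 2 * N' (x + v) x" by (rule tau_F2)
  then have "tau v (F2 x x) + tau x (F2 x v) = 2 * (2 * N' x v)"
    using tau_F2[of x x] tau_F2[of v x]
    by (simp add: tau_linear GF.F.bilinear GF.F.commute[of v x] GF.N.deriv_def GF.N.trilinear
        GF.N.commute[of v x] GF.N.commute'[of x v x])
  then show ?thesis using tau_F2[of x v] by (simp add: GF.F.self tau_linear)
qed

lemma tau_F2': "tau v (F2 x y) = N3 x y v"
proof -
  have "tau v (F (x + y)) = N' (x + y) v" by (rule tau_F)
  then show ?thesis
    by (simp add: GF.F.quad_add tau_linear tau_F GF.N.deriv_def GF.N.trilinear GF.N.commute[of y x]
        add_divide_distrib)
qed

section \<open>Normalization by a linear map\<close>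

abbreviation T :: "complex ^ 'n \<Rightarrow> complex" where
  "T \<equiv> N' e"

text \<open>\<open>Q\<close> is minus the derivative of \<open>G / M\<close> at \<open>F e\<close>,
  and \<open>Q'\<close> is minus the derivative of \<open>F / N\<close> at \<open>e\<close>. These
  two rational maps are mutually inverse, and so are \<open>Q\<close> and \<open>Q'\<close>.\<close>

definition Q :: "complex ^ 'n \<Rightarrow> complex ^ 'n" where
  "Q a = M' (F e) a *s e - G2 (F e) a"

definition Q' :: "complex ^ 'n \<Rightarrow> complex ^ 'n" where
  "Q' x = T x *s F e - F2 e x"

lemma Q_linear: "Q (x + y) = Q x + Q y" "Q (c *s x) = c *s Q x"
  by (simp_all add: Q_def FG.N.deriv_linear GF.G.bilinear vec_eq_iff algebra_simps)

lemma Q'_linear: "Q' (x + y) = Q' x + Q' y" "Q' (c *s x) = c *s Q' x"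
  by (simp_all add: Q'_def GF.N.deriv_linear GF.F.bilinear vec_eq_iff algebra_simps)

lemma G_F_e: "G (F e) = e"
  by (simp add: GF.comp N_e)

lemma Q_F2_e: "Q (F2 e x) = T x *s e - x"
  using GF.comp_deriv[of e x] deriv_M_F_F2[of e x] by (simp add: Q_def N_e vec_eq_iff algebra_simps)

lemma Q_F_e: "Q (F e) = e"
  by (simp add: Q_def FG.N.deriv_self M_F N_e GF.G.self G_F_e vec_eq_iff)

lemma Q_Q': "Q (Q' x) = x"
proof -
  have "Q (Q' x) = T x *s Q (F e) - Q (F2 e x)"
    using Q_linear(1)[of "Q' x" "F2 e x"] by (simp add: Q'_def Q_linear)
  then show ?thesis by (simp add: Q_F_e Q_F2_e)
qed

lemma matrix_Q: "matrix Q *v x = Q x" "matrix Q' *v x = Q' x"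
  by (rule matrix_works, unfold_locales, simp_all add: Q_linear Q'_linear)+

lemma Q_inverse: "matrix Q ** matrix Q' = mat 1" "matrix Q' ** matrix Q = mat 1"
proof -
  have "(matrix Q ** matrix Q') *v x = mat 1 *v x" for x
    by (simp add: matrix_vector_mul_assoc[symmetric] matrix_Q Q_Q')
  then show "matrix Q ** matrix Q' = mat 1" by (simp add: matrix_eq)
  then show "matrix Q' ** matrix Q = mat 1" using matrix_left_right_inverse by blast
qed

lemma Q'_Q: "Q' (Q x) = x"
  by (metis Q_inverse(2) matrix_Q matrix_vector_mul_assoc matrix_vector_mul_lid)

text \<open>Expand \<open>F\<close> on the difference defining \<open>Q (F x)\<close>. The mixed
  term comes from the first linearization of \<open>F (G y) = M y *s y\<close> at
  \<open>F e\<close>, the term \<open>F (G2 (F e) (F x))\<close> from the second one, where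
  \<open>N_dvd_deriv_M_F\<close> and \<open>tau_F\<close> turn \<open>M' (F x) (F e)\<close> into
  \<open>N x * T x\<close>.\<close>

lemma F_Q_F: "F (Q (F x)) = N x *s Q' x"
proof -
  have 1: "F2 e (G2 (F e) (F x)) = F x + M' (F e) (F x) *s F e"
    using FG.comp_deriv[of "F e" "F x"] by (simp add: G_F_e M_F N_e)
  have 2: "F (G2 (F e) (F x)) = M' (F e) (F x) *s F x + (N x * T x) *s F e - N x *s F2 e x"
    using FG.comp_deriv2[of "F e" "F x"]
    unfolding G_F_e GF.comp N_dvd_deriv_M_F[of x] tau_F GF.F.scale_right by (simp add: eq_diff_eq N_e)
  show ?thesis
    unfolding Q_def GF.F.quad_diff GF.F.quad_scale GF.F.scale_left 1 2 Q'_def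
    by (simp add: vec_eq_iff algebra_simps power2_eq_square)
qed

lemma Q_F_Q_F: "Q (F (Q (F x))) = N x *s x"
  by (simp add: F_Q_F Q_linear Q_Q')

text \<open>Write \<open>F x\<close> as \<open>Q' (Q (F x))\<close> in \<open>tau_F\<close> and
  expand \<open>Q'\<close>. The result is the trace form of \<open>N\<close> at \<open>e\<close>,
  paired with the adjoint \<open>Q (F x)\<close>.\<close>

lemma trace_Q_F: "N' x y = T y * T (Q (F x)) - N3 e y (Q (F x))"
proof -
  have "N' x y = tau y (Q' (Q (F x)))" by (simp add: Q'_Q tau_F)
  then show ?thesis
    by (simp add: Q'_def tau_linear tau_F tau_F2' GF.N.commute'[of e y] mult.commute)
qed

end

section \<open>The Jordan algebra of a cubic norm structure\<close>

text \<open>The axioms of a cubic norm structure with adjoint \<open>A\<close>: the adjoint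
  identity, the derivative of the norm as the trace form against the adjoint (\<open>tr\<close>
  below), and the rule for the base point.\<close>

locale cubic_norm =
  A: sym_bilinear A2 + N: sym_trilinear N3
  for A2 :: "complex ^ 'n \<Rightarrow> complex ^ 'n \<Rightarrow> complex ^ 'n"
    and N3 :: "complex ^ 'n \<Rightarrow> complex ^ 'n \<Rightarrow> complex ^ 'n \<Rightarrow> complex" +
  fixes e :: "complex ^ 'n"
  assumes adj_adj: "A.quad (A.quad x) = N.cubic x *s x"
    and deriv_eq: "N.deriv x y = N.deriv e y * N.deriv e (A.quad x) - N3 e y (A.quad x)"
    and A2_unit: "A2 e y = N.deriv e y *s e - y"
    and N_unit: "N.cubic e = 1"
begin

text \<open>The adjoint is its own partner, so the linearized identities and
  \<open>N (A x) = (N x)\<^sup>2\<close> are inherited.\<close>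

sublocale AA: quadro_quadric A2 A2 N3 N3
  by unfold_locales (rule adj_adj)+

abbreviation A :: "complex ^ 'n \<Rightarrow> complex ^ 'n" where "A \<equiv> A.quad"
abbreviation N :: "complex ^ 'n \<Rightarrow> complex" where "N \<equiv> N.cubic"
abbreviation T :: "complex ^ 'n \<Rightarrow> complex" where "T \<equiv> N.deriv e"
abbreviation S :: "complex ^ 'n \<Rightarrow> complex" where "S x \<equiv> T (A x)"

text \<open>Minus the second derivative of the logarithm of \<open>N\<close> at \<open>e\<close>,
  where \<open>N e = 1\<close>.\<close>

definition tr :: "complex ^ 'n \<Rightarrow> complex ^ 'n \<Rightarrow> complex" where
  "tr x y = T x * T y - N3 e x y"

text \<open>The polarization of the squaring \<open>A x + T x *s x - S x *s e\<close>; the form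
  \<open>N3 e\<close> is the polarization of \<open>S\<close>.\<close>

definition prod :: "complex ^ 'n \<Rightarrow> complex ^ 'n \<Rightarrow> complex ^ 'n" where
  "prod x y = (1 / 2) *s (A2 x y + T x *s y + T y *s x - N3 e x y *s e)"

lemma T_linear: "T (x + y) = T x + T y" "T (x - y) = T x - T y" "T (c *s x) = c * T x"
  by (simp_all add: N.deriv_linear)

lemma tr_commute: "tr x y = tr y x"
  by (simp add: tr_def N.commute'[of e x])

lemma tr_linear: "tr (x + y) z = tr x z + tr y z" "tr (x - y) z = tr x z - tr y z"
  "tr (c *s x) z = c * tr x z"
  by (simp_all add: tr_def T_linear N.trilinear algebra_simps)

lemma tr_linear_right: "tr z (x + y) = tr z x + tr z y" "tr z (x - y) = tr z x - tr z y"
  "tr z (c *s x) = c * tr z x"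
  by (simp_all add: tr_commute[of z] tr_linear)

lemma T_e: "T e = 3"
  by (simp add: N.deriv_self N_unit)

lemma N3_e_e: "N3 e e x = 2 * T x"
  by (simp add: N.deriv_def)

lemma tr_e: "tr x e = T x"
  by (simp add: tr_def T_e N.commute'[of e x] N3_e_e)

lemma deriv_tr: "N.deriv x y = tr (A x) y"
  using deriv_eq[of x y] by (simp add: tr_def N.commute'[of e y] mult.commute)

lemma tr_A2: "tr (A2 x y) z = N3 x y z"
proof -
  have "N.deriv (x + y) z = tr (A (x + y)) z" by (rule deriv_tr)
  then show ?thesis
    by (simp add: A.quad_add tr_linear N.deriv_add flip: deriv_tr)
qed

lemma T_A2: "T (A2 x y) = T x * T y - tr x y"
  using tr_A2[of x y e] unfolding tr_e by (simp add: tr_def N.commute'[of x y e] N.commute[of x e y])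

lemma A_e: "A e = e"
proof -
  have "2 *s A e = 2 *s e" using A2_unit[of e] by (simp add: A.self T_e vec_eq_iff)
  then show ?thesis by (simp add: vec_eq_iff)
qed

lemma A2_A_A2: "A2 (A x) (A2 x y) = N x *s y + tr (A x) y *s x"
  using AA.GF.comp_deriv[of x y] by (simp add: deriv_tr)

text \<open>Replace \<open>x\<close> by \<open>A x\<close> in \<open>A2_A_A2\<close>; the adjoint
  identity puts a factor \<open>N x\<close> on both sides, which density allows to cancel.\<close>

lemma A2_A2_A: "A2 x (A2 (A x) y) = tr x y *s A x + N x *s y"
proof -
  have hom_tr: "hom_poly 1 (\<lambda>x. tr x y)" unfolding tr_def
    by (intro hom_poly_diff hom_poly_mult[OF N.hom_poly_deriv[OF hom_map_const hom_map_id refl] hom_poly.const]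
        N.hom_poly[OF hom_map_const hom_map_id hom_map_const]) auto
  have "A2 x (A2 (A x) y) - (tr x y *s A x + N x *s y) = 0"
  proof (rule hom_map_dense[where f = N and ?x0.0 = e
        and g = "\<lambda>x. A2 x (A2 (A x) y) - (tr x y *s A x + N x *s y)"])
    show "hom_poly 3 N" by (rule N.hom_poly_cubic[OF hom_map_id]) simp
    show "hom_map 3 (\<lambda>x. A2 x (A2 (A x) y) - (tr x y *s A x + N x *s y))"
      by (intro hom_map_diff hom_map_add
          A.hom_map[OF hom_map_id A.hom_map[OF A.hom_map_quad[OF hom_map_id refl] hom_map_const refl]]
          hom_map_scale[OF hom_tr A.hom_map_quad[OF hom_map_id refl]]
          hom_map_scale[OF N.hom_poly_cubic[OF hom_map_id refl] hom_map_const]) auto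
    fix x assume "N x \<noteq> 0"
    moreover have "N x *s (A2 x (A2 (A x) y) - (tr x y *s A x + N x *s y)) = 0"
      using A2_A_A2[of "A x" y]
      by (simp add: adj_adj AA.M_F A.scale_left tr_linear vec_eq_iff algebra_simps power2_eq_square)
    ultimately show "A2 x (A2 (A x) y) - (tr x y *s A x + N x *s y) = 0"
      using vec.scale_eq_0_iff by blast
  qed (simp add: N_unit)
  then show ?thesis by simp
qed

text \<open>Put \<open>y = e\<close> in \<open>A2_A_A2\<close> and expand the left side by
  \<open>A2_unit\<close>.\<close>

lemma A2_A: "A2 x (A x) = (T x * S x - N x) *s e - S x *s x - T x *s A x"
proof -
  have "A2 (A x) (A2 x e) = N x *s e + S x *s x" by (simp add: A2_A_A2 tr_e)
  moreover have "A2 (A x) (A2 x e) = T x *s (S x *s e - A x) - A2 x (A x)"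
    by (simp add: A.commute[of _ e] A2_unit A.bilinear A.commute[of "A x" x])
  ultimately show ?thesis by (simp add: vec_eq_iff algebra_simps)
qed

lemma tr_A: "tr x (A x) = 3 * N x"
  using deriv_tr[of x x] by (simp add: tr_commute N.deriv_self)

text \<open>By \<open>tr_A2\<close> the expression is the symmetric form \<open>N3\<close> at
  \<open>x\<close>, \<open>y\<close>, \<open>A x\<close>, so \<open>y\<close> can be moved outside
  and \<open>A2_A\<close> applied.\<close>

lemma tr_A_A2: "tr (A x) (A2 x y) = (T x * S x - N x) * T y - S x * tr x y - T x * tr (A x) y"
proof -
  have "tr (A x) (A2 x y) = tr (A2 x (A x)) y"
    by (simp add: tr_commute[of "A x"] tr_A2 N.commute')
  then show ?thesis by (simp add: A2_A tr_linear tr_e tr_commute[of e] algebra_simps)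
qed

lemma tr_x_A2_A: "tr x (A2 (A x) y) = tr (A x) (A2 x y)"
  by (simp add: tr_commute[of x] tr_commute[of "A x"] tr_A2 N.commute N.commute')

section \<open>The Jordan product and its identities\<close>

lemma prod_tr: "prod x y = (1 / 2) *s (A2 x y + T x *s y + T y *s x - (T x * T y - tr x y) *s e)"
  by (simp add: prod_def tr_def)

lemma prod_commute: "prod x y = prod y x"
  by (simp add: prod_def A.commute[of x y] N.commute'[of e x y] add_ac)

lemma prod_linear: "prod (x + y) z = prod x z + prod y z" "prod (x - y) z = prod x z - prod y z"
  "prod (c *s x) z = c *s prod x z"
  by (simp_all add: prod_def A.bilinear T_linear N.trilinear vec_eq_iff algebra_simps
      add_divide_distrib diff_divide_distrib)

lemma prod_linear_right: "prod z (x + y) = prod z x + prod z y" "prod z (x - y) = prod z x - prod z y"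
  "prod z (c *s x) = c *s prod z x"
  by (simp_all add: prod_commute[of z] prod_linear)

lemma prod_unit: "prod e x = x"
  by (simp add: prod_def A2_unit T_e N3_e_e vec_eq_iff algebra_simps)

lemma prod_self: "prod x x = A x + T x *s x - S x *s e"
proof -
  have "N3 e x x = 2 * S x" using T_A2[of x x] by (simp add: A.self T_linear tr_def)
  then show ?thesis by (simp add: prod_def A.self vec_eq_iff algebra_simps add_divide_distrib diff_divide_distrib)
qed

lemma T_prod: "T (prod x y) = tr x y"
  by (simp add: prod_tr T_linear T_A2 T_e algebra_simps)

lemma prod_A: "prod x (A x) = N x *s e"
  by (simp add: prod_tr A2_A tr_A vec_eq_iff algebra_simps)

text \<open>The heart of the Jordan identity: multiplications by \<open>x\<close> and by its adjoint
  commute. Steps 1 to 4 evaluate the \<open>A2\<close> and \<open>tr\<close> terms of the two outer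
  products; the identities above then bring both sides to the same expression.\<close>

lemma prod_A_prod: "prod (A x) (prod x y) = prod x (prod (A x) y)"
proof -
  define n where "n = T x * T y - tr x y"
  define n' where "n' = S x * T y - tr (A x) y"
  have comm: "A2 (A x) x = A2 x (A x)" by (rule A.commute)
  have e_right: "A2 z e = T z *s e - z" for z by (simp add: A.commute[of z] A2_unit)
  have 1: "A2 (A x) (prod x y) = (1 / 2) *s (N x *s y + tr (A x) y *s x + T x *s A2 (A x) y
      + T y *s A2 x (A x) - n *s (S x *s e - A x))"
    by (simp add: prod_tr A.bilinear A2_A_A2 comm e_right flip: n_def)
  have 2: "tr (A x) (prod x y) = (1 / 2) * (tr (A x) (A2 x y) + T x * tr (A x) y + T y * (3 * N x) - n * S x)"
    by (simp add: prod_tr tr_linear_right tr_e tr_commute[of "A x" x] tr_A flip: n_def)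
  have 3: "A2 x (prod (A x) y) = (1 / 2) *s (tr x y *s A x + N x *s y + S x *s A2 x y
      + T y *s A2 x (A x) - n' *s (T x *s e - x))"
    by (simp add: prod_tr[of "A x"] A.bilinear A2_A2_A e_right flip: n'_def)
  have 4: "tr x (prod (A x) y) = (1 / 2) * (tr (A x) (A2 x y) + S x * tr x y + T y * (3 * N x) - n' * T x)"
    by (simp add: prod_tr[of "A x"] tr_linear_right tr_e tr_x_A2_A tr_A flip: n'_def)
  have "prod (A x) (prod x y) $ i = prod x (prod (A x) y) $ i" for i
    unfolding prod_tr[of "A x" "prod x y"] prod_tr[of x "prod (A x) y"] T_prod 1 2 3 4 A2_A tr_A_A2
    by (simp add: prod_tr n_def n'_def field_simps)
  then show ?thesis by (simp add: vec_eq_iff)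
qed

text \<open>The square of \<open>x\<close> is \<open>A x\<close> plus multiples of \<open>x\<close>
  and \<open>e\<close>, and multiplication by each of these commutes with multiplication by
  \<open>x\<close>.\<close>

lemma jordan_identity: "prod (prod x x) (prod x y) = prod x (prod (prod x x) y)"
  by (simp add: prod_self prod_linear prod_linear_right prod_unit prod_A_prod)

lemma jordan: "jordan_algebra prod e"
  unfolding jordan_algebra_def
  by (intro conjI allI jordan_identity prod_unit prod_commute) (simp only: prod_linear)

lemma adjoint: "jordan_adjoint prod e T S = A"
  by (rule ext) (simp add: jordan_adjoint_def prod_self)

lemma cube: "prod x (prod x x) = T x *s prod x x - S x *s x + N x *s e"
proof -
  have "prod x (prod x x) = N x *s e + T x *s prod x x - S x *s x"
    by (simp add: prod_self[of x] prod_linear_right prod_A prod_commute[of x e] prod_unit)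
  then show ?thesis by (simp add: algebra_simps)
qed

lemma rank3: "rank3_data prod e T S N"
proof -
  have "hom_poly 1 T" by (rule N.hom_poly_deriv[OF hom_map_const hom_map_id]) simp
  moreover have "hom_poly 2 S"
    by (rule N.hom_poly_deriv[OF hom_map_const A.hom_map_quad[OF hom_map_id refl]]) simp
  moreover have "hom_poly 3 N" by (rule N.hom_poly_cubic[OF hom_map_id]) simp
  ultimately show ?thesis
    unfolding rank3_data_def hom_poly_lin_form hom_poly_quad_form hom_poly_cubic_form
    by (simp add: cube algebra_simps)
qed

text \<open>The span is closed under \<open>prod\<close>: the cubic equation reduces the third
  power, the Jordan identity with \<open>y = x\<close> the square of the square, and bilinearity
  extends this from generators to the span.\<close>

lemma gen_subalg_subset: "gen_subalg prod e x \<subseteq> vec.span {e, x, prod x x}"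
proof -
  define B where "B = {e, x, prod x x}"
  have "prod x x \<in> vec.span B" "x \<in> vec.span B" "e \<in> vec.span B"
    by (auto simp: B_def intro: vec.span_base)
  note B = this
  have cube_in: "prod x (prod x x) \<in> vec.span B"
    unfolding cube using B by (intro vec.span_add vec.span_diff vec.span_scale)
  have "prod (prod x x) (prod x x) = prod x (prod x (prod x x))"
    using jordan_identity[of x x] by (simp add: prod_commute)
  also have "\<dots> = T x *s prod x (prod x x) - S x *s prod x x + N x *s x"
    by (subst cube) (simp add: prod_linear_right prod_commute[of x e] prod_unit)
  also have "\<dots> \<in> vec.span B"
    using B cube_in by (intro vec.span_add vec.span_diff vec.span_scale)
  finally have "prod (prod x x) (prod x x) \<in> vec.span B" .
  then have base: "prod a b \<in> vec.span B" if "a \<in> B" "b \<in> B" for a b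
    using that B cube_in unfolding B_def by (auto simp: prod_unit prod_commute)
  have "prod a b \<in> vec.span B" if "a \<in> B" "b \<in> vec.span B" for a b
    using that(2)
  proof (induction rule: vec.span_induct)
    case base
    show ?case by (auto intro!: vec.subspaceI simp: prod_linear_right vec.span_add vec.span_scale
        vec.span_zero prod_linear_right(3)[of a 0 0, simplified])
  qed (use base that in auto)
  then have "prod b a \<in> vec.span B" if "a \<in> B" "b \<in> vec.span B" for a b
    using that by (simp add: prod_commute)
  moreover have "prod b a \<in> vec.span B" if "a \<in> vec.span B" "b \<in> vec.span B" for a b
    using that(1)
  proof (induction rule: vec.span_induct)
    case base
    show ?case by (auto intro!: vec.subspaceI simp: prod_linear_right vec.span_add vec.span_scale
        vec.span_zero prod_linear_right(3)[of b 0 0, simplified])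
  qed (use calculation that in auto)
  ultimately have "vec.span B \<in> {V. vec.subspace V \<and> e \<in> V \<and> x \<in> V \<and> (\<forall>a\<in>V. \<forall>b\<in>V. prod a b \<in> V)}"
    using B by auto
  then show ?thesis unfolding gen_subalg_def B_def by blast
qed

text \<open>The span bounds the dimension by 3 everywhere; at \<open>v\<close> the bound is
  attained, since a linear relation among \<open>e\<close>, \<open>v\<close> and its square would
  produce a zero of \<open>A\<close> on the line.\<close>

lemma jordan_rank_eq_3:
  assumes v: "\<And>t. A (t *s e + v) \<noteq> 0"
  shows "jordan_rank prod e = 3"
proof -
  let ?B = "\<lambda>x. {e, x, prod x x}"
  have le: "vec.dim (gen_subalg prod e x) \<le> 3" for x
  proof -
    have "vec.dim (gen_subalg prod e x) \<le> card (?B x)"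
      by (rule vec.dim_le_card[OF gen_subalg_subset]) simp
    also have "\<dots> \<le> 3" by (simp add: card_insert_if)
    finally show ?thesis .
  qed
  have line: "A (t *s e + v) = (t\<^sup>2 + t * T v) *s e - t *s v + A v" for t
    unfolding A.quad_line by (simp add: A_e A2_unit vec_eq_iff algebra_simps)
  have not_multiple: "v \<noteq> s *s e" for s
  proof
    assume "v = s *s e"
    then have "A (- s *s e + v) = 0" by simp
    then show False using v by blast
  qed
  have A_v: "A v \<noteq> a *s e + b *s v" for a b
  proof
    assume Av: "A v = a *s e + b *s v"
    have Sv: "S v = 3 * a + b * T v" by (simp add: Av T_linear T_e)
    \<comment> \<open>Multiplying the supposed relation by \<open>v\<close> gives a relation between
      \<open>v\<close> and \<open>e\<close>, so the coefficient of \<open>v\<close> vanishes. The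
      same scalar is the coefficient of \<open>e\<close> in \<open>A (b *s e + v)\<close>, which is
      then zero.\<close>
    have "N v *s e = prod v (A v)" by (simp add: prod_A)
    also have "\<dots> = a *s v + b *s prod v v"
      unfolding Av by (simp add: prod_linear_right prod_commute[of v e] prod_unit)
    also have "\<dots> = a *s v + b *s (a *s e + b *s v + T v *s v - S v *s e)"
      by (simp only: prod_self Av)
    finally have "(a + b * b + b * T v) *s v = (N v - a * b + b * S v) *s e"
      by (simp add: vec_eq_iff algebra_simps)
    then have z: "a + b * b + b * T v = 0"
      using not_multiple[of "(N v - a * b + b * S v) / (a + b * b + b * T v)"]
      by (metis divide_inverse_commute vec.scale_left_imp_eq vec.scale_scale left_inverse vec.scale_one)
    have "A (b *s e + v) = (a + b * b + b * T v) *s e"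
      unfolding line Av by (simp add: vec_eq_iff algebra_simps power2_eq_square)
    then show False using v[of b] z by simp
  qed
  have "e \<noteq> 0" using N_unit by auto
  have "v \<notin> vec.span {e}"
    using not_multiple by (auto simp: vec.span_singleton)
  moreover have "prod v v \<notin> vec.span {v, e}"
  proof
    assume "prod v v \<in> vec.span {v, e}"
    then obtain b a where "prod v v - b *s v = a *s e"
      by (auto simp: vec.span_breakdown_eq vec.span_singleton)
    then have "A v = (a + S v) *s e + (b - T v) *s v"
      by (simp add: prod_self vec_eq_iff algebra_simps)
    then show False using A_v by blast
  qed
  ultimately have ind: "vec.independent {prod v v, v, e}"
    using \<open>e \<noteq> 0\<close> by (auto simp: vec.independent_insert)
  have "card {prod v v, v, e} = 3"
    using \<open>v \<notin> vec.span {e}\<close> \<open>prod v v \<notin> vec.span {v, e}\<close>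
    by (auto simp: card_insert_if dest: vec.span_base[of _ "{e}"] vec.span_base[of _ "{v, e}"])
      (auto intro: vec.span_base)
  moreover have "{prod v v, v, e} \<subseteq> gen_subalg prod e v"
    by (auto simp: gen_subalg_def)
  ultimately have "3 \<le> vec.dim (gen_subalg prod e v)"
    using ind by (metis vec.dim_eq_card_independent vec.dim_subset)
  then have "3 \<in> (\<lambda>x. vec.dim (gen_subalg prod e x)) ` UNIV"
    using le[of v] by (auto intro!: image_eqI[of _ _ v])
  moreover have "finite ((\<lambda>x. vec.dim (gen_subalg prod e x)) ` UNIV)"
    by (rule finite_subset[of _ "{..3}"]) (use le in auto)
  ultimately show ?thesis unfolding jordan_rank_def
    by (intro Max_eqI) (use le in auto)
qed

end

section \<open>The Jordan algebra of a quadro-quadric map\<close>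

context pointed_quadro_quadric
begin

lemma sym_bilinear_Q_F2: "sym_bilinear (\<lambda>x y. Q (F2 x y))"
  by unfold_locales (simp_all add: GF.F.bilinear Q_linear GF.F.commute)

lemma quad_Q_F2: "sym_bilinear.quad (\<lambda>x y. Q (F2 x y)) = (\<lambda>x. Q (F x))"
  by (rule ext) (simp add: sym_bilinear.quad_def[OF sym_bilinear_Q_F2] GF.F.quad_def Q_linear)

lemma cubic_norm_Q_F2: "cubic_norm (\<lambda>x y. Q (F2 x y)) N3 e"
proof -
  interpret A: sym_bilinear "\<lambda>x y. Q (F2 x y)" by (rule sym_bilinear_Q_F2)
  show ?thesis
    by unfold_locales (simp_all add: quad_Q_F2 Q_F_Q_F N_e Q_F2_e flip: trace_Q_F)
qed

end

lemma complex_root_exists: "\<exists>z :: complex. z ^ 3 = c"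
proof -
  have "(exp (ln c / 3)) ^ 3 = c" if "c \<noteq> 0" using that by (simp flip: exp_of_nat_mult)
  then show ?thesis by (cases "c = 0") auto
qed

text \<open>\<open>parallel\<close> allows proportionality in either direction; inverting the
  scalar, or noting that \<open>x = 0\<close> when it is zero, makes \<open>G (F x)\<close> a
  multiple of \<open>x\<close>. By \<open>hom_map_parallel_id\<close> the factor is then a cubic
  form.\<close>

lemma rat_left_inverse_cubic:
  fixes F G :: "complex ^ 'n \<Rightarrow> complex ^ 'n"
  assumes "sym_bilinear F2" "sym_bilinear G2"
    and F: "F = sym_bilinear.quad F2" and G: "G = sym_bilinear.quad G2"
    and inv: "rat_left_inverse G F"
  shows "\<exists>N3. cubic_composition F2 G2 N3 \<and> (\<exists>x. sym_trilinear.cubic N3 x \<noteq> 0)"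
proof -
  interpret F: sym_bilinear F2 by fact
  interpret G: sym_bilinear G2 by fact
  have par: "\<exists>c. G (F x) = c *s x" for x
  proof -
    have "(\<exists>c. G (F x) = c *s x) \<or> (\<exists>c. x = c *s G (F x))"
      using inv unfolding rat_left_inverse_def same_rat_map_def parallel_def by auto
    then consider c where "G (F x) = c *s x" | c where "x = c *s G (F x)" by blast
    then show ?thesis
    proof cases
      case (2 c)
      show ?thesis
      proof (cases "c = 0")
        case True
        then have "x = 0" using 2 by simp
        then show ?thesis by (simp add: F G)
      next
        case False
        then have "G (F x) = (1 / c) *s x" using 2 by (metis divide_self_if times_divide_eq_left
          mult_1 vec.scale_one vec.scale_scale)
        then show ?thesis by blast
      qed
    qed blast
  qed
  have "hom_map (Suc 3) (\<lambda>x. G (F x))" unfolding F G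
    by (rule G.hom_map_quad[OF F.hom_map_quad[OF hom_map_id refl]]) simp
  from hom_map_parallel_id[OF this par] obtain N where
    N: "hom_poly 3 N" "\<And>x. G (F x) = N x *s x" by blast
  then obtain N3 where N3: "sym_trilinear N3" "N = sym_trilinear.cubic N3"
    using hom_poly_3_obtains_trilinear by blast
  interpret N: sym_trilinear N3 by (rule N3)
  have "cubic_composition F2 G2 N3"
    by unfold_locales (use N N3 F G in auto)
  moreover obtain x where "G (F x) \<noteq> 0"
    using inv unfolding rat_left_inverse_def same_rat_map_def by auto
  then have "N x \<noteq> 0" using N by auto
  ultimately show ?thesis using N3 by blast
qed

theorem theorem3p4:
  fixes f :: "complex ^ 'n \<Rightarrow> complex ^ 'n"
  assumes "bir22 f"
  shows "\<exists>m e T S N. jordan_algebra m e \<and> jordan_rank m e = 3 \<and> rank3_data m e T S N \<and>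
           lin_equiv f (jordan_adjoint m e T S) \<and>
           same_rat_map (jordan_adjoint m e T S \<circ> jordan_adjoint m e T S) id"
proof -
  obtain g where quad: "quad_map f" "quad_map g" and ncf: "\<not> has_common_factor f"
    and inv: "rat_left_inverse g f" "rat_left_inverse f g"
    using assms unfolding bir22_def by blast
  obtain F2 G2 where F2: "sym_bilinear F2" "f = sym_bilinear.quad F2"
    and G2: "sym_bilinear G2" "g = sym_bilinear.quad G2"
    using quad quad_map_obtains_bilinear by metis
  obtain N3 x0 where N3: "cubic_composition F2 G2 N3" "sym_trilinear.cubic N3 x0 \<noteq> 0"
    using rat_left_inverse_cubic[OF F2(1) G2(1) F2(2) G2(2) inv(1)] by blast
  obtain M3 where M3: "cubic_composition G2 F2 M3"
    using rat_left_inverse_cubic[OF G2(1) F2(1) G2(2) F2(2) inv(2)] by blast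
  interpret quadro_quadric F2 G2 N3 M3 using N3(1) M3 by (rule quadro_quadric.intro)
  \<comment> \<open>Scaling \<open>x0\<close> by \<open>s\<close> multiplies the norm by the cube of
    \<open>s\<close>, which normalizes it to 1.\<close>
  obtain s where s: "s ^ 3 = 1 / GF.N.cubic x0" using complex_root_exists by blast
  define e where "e = s *s x0"
  have N_e: "GF.N.cubic e = 1" using s N3(2) by (simp add: e_def GF.N.cubic_scale)
  then have "f e \<noteq> 0" using N_zero_if[of e] F2(2) by auto
  from line_without_zeros[OF F2 ncf this] obtain R d v where
    R: "hom_poly d R" "R v \<noteq> 0" "\<forall>v. R v \<noteq> 0 \<longrightarrow> (\<forall>t. f (t *s e + v) \<noteq> 0)" by blast
  interpret pointed_quadro_quadric F2 G2 N3 M3 e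
    by unfold_locales (use N_e R F2(2) in blast)+
  interpret J: cubic_norm "\<lambda>x y. Q (F2 x y)" N3 e by (rule cubic_norm_Q_F2)
  \<comment> \<open>The linear equivalence uses \<open>Q\<close> on the left and the identity on the
    right.\<close>
  have A: "J.A = (\<lambda>x. matrix Q *v f (mat 1 *v x))"
    by (simp add: quad_Q_F2 matrix_Q F2(2))
  have e: "J.A e \<noteq> 0" "e \<noteq> 0" using J.A_e J.N_unit by auto
  \<comment> \<open>As \<open>Q\<close> is injective, a zero of the adjoint is a zero of
    \<open>f\<close>.\<close>
  have "J.A (t *s e + v) \<noteq> 0" for t
  proof
    assume "J.A (t *s e + v) = 0"
    then have "Q' (Q (f (t *s e + v))) = Q' 0" by (simp add: quad_Q_F2 F2(2))
    moreover have "Q' 0 = 0" using Q'_linear(2)[of 0 0] by simp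
    ultimately show False using R(2,3) by (simp add: Q'_Q)
  qed
  then have "jordan_rank J.prod e = 3" by (rule J.jordan_rank_eq_3)
  moreover have "lin_equiv f J.A"
    unfolding lin_equiv_def
  proof (intro exI conjI)
    show "invertible (matrix Q)" using Q_inverse unfolding invertible_def by blast
    show "invertible (mat 1 :: complex ^ 'n ^ 'n)" unfolding invertible_def by (metis matrix_mul_lid)
    show "same_rat_map J.A (\<lambda>x. matrix Q *v f (mat 1 *v x))"
      using e unfolding A[symmetric] same_rat_map_def parallel_def by (metis vec.scale_one)
  qed
  moreover have "same_rat_map (J.A \<circ> J.A) id"
    unfolding same_rat_map_def parallel_def
  proof (intro conjI allI)
    show "\<exists>x. (J.A \<circ> J.A) x \<noteq> 0" using e J.A_e by (intro exI[of _ e]) simp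
    show "\<exists>x :: complex ^ 'n. id x \<noteq> 0" using e by auto
    show "(\<exists>c. (J.A \<circ> J.A) x = c *s id x) \<or> (\<exists>c. id x = c *s (J.A \<circ> J.A) x)" for x
      using J.adj_adj by auto
  qed
  ultimately show ?thesis
    using J.jordan J.rank3 J.adjoint by metis
qed

end
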